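(* Let $\mathcal{G}$ be a finite connected groupoid with object set $\mathcal{G}_0$, let $x\in\mathcal{G}_0$, and let $\alpha=(A_g,\alpha_g)_{g\in\mathcal{G}}$ be a unital group-type partial action of $\mathcal{G}$ on a ring $A=\bigoplus_{y\in\mathcal{G}_0}A_y$. Let $\tau(x)=\{\tau_y : y\in\mathcal{G}_0\}$ be a transversal for $x$ with $A_{\tau_y^{-1}}=A_x$ and $A_{\tau_y}=A_y$ for all $y\in\mathcal{G}_0$. Suppose that (i) there exists $a_x\in C(A_x)$ such that $t_x(a_x)=1_x$, where $t_x(a_x)=\sum_{h\in\mathcal{G}(x)}\alpha_h(a_x1_{h^{-1}})$; and (ii) there exists $a\in C(A)$ such that $\sum_{z\in\mathcal{G}_0}\alpha_{\tau_z^{-1}}(a1_z)=1_x$. Then $A\subset A\star_\alpha\mathcal{G}$ is a left (right) semisimple extension.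
   Context: Rings are associative, not necessarily unital; $C(R)$ is the center of $R$. A groupoid is a small category in which every morphism is invertible; for $g:x\to y$ write $s(g)=x$, $t(g)=y$; objects are identified with their identity morphisms; $gh$ is defined iff $s(g)=t(h)$. $\mathcal{G}(x)=\{g : s(g)=t(g)=x\}$ is the isotropy group. $\mathcal{G}$ is connected if any two objects are joined by a morphism. A partial action of $\mathcal{G}$ on a ring $A$ is a family $\alpha=(A_g,\alpha_g)_{g\in\mathcal{G}}$ such that: (i) $A_g$ is an ideal of $A_{t(g)}$ and $A_{t(g)}$ is an ideal of $A$ for all $g$; (ii) $\alpha_g:A_{g^{-1}}\to A_g$ is a ring isomorphism; (iii) $\alpha_y=\mathrm{id}_{A_y}$ for each object $y$; (iv) $\alpha_{gh}$ extends $\alpha_g\alpha_h$ (defined on $\alpha_h^{-1}(A_{g^{-1}}\cap A_h)$) whenever $s(g)=t(h)$. It is unital if for each $g$ there is a central idempotent $1_g$ of $A$ with $A_g=A1_g$. A transversal for $x$ is a family $\tau(x)=\{\tau_y\}_{y\in\mathcal{G}_0}$ of morphisms $\tau_y:x\to y$ with $\tau_x=x$. A partial action $\alpha$ of a connected groupoid is group-type if for some object $x$ there is a transversal $\{\tau_y\}$ for $x$ with $A_{\tau_y^{-1}}=A_x$ and $A_{\tau_y}=A_y$ for all $y$ (this does not depend on the choice of $x$). For a unital partial action, the partial skew groupoid ring $A\star_\alpha\mathcal{G}$ is the set of finite formal sums $\sum_g a_g\delta_g$, $a_g\in A_g$, with componentwise addition and $(a_g\delta_g)(a_h\delta_h)=a_g\alpha_g(a_h1_{g^{-1}})\delta_{gh}$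 if $s(g)=t(h)$ and $0$ otherwise. When $\mathcal{G}_0$ is finite it has identity $\sum_{y\in\mathcal{G}_0}1_y\delta_y$ and is a ring extension of $A$ via $a\mapsto\sum_{y\in\mathcal{G}_0}(a1_y)\delta_y$. A unital ring extension $R\subset S$ is left (right) semisimple if every left (right) $S$-submodule $N$ of a left (right) $S$-module $M$ which has an $R$-complement in $M$ (i.e. is a direct summand of $M$ as an $R$-module) has an $S$-complement in $M$ (i.e. is a direct summand as an $S$-module). "Left (right)" means that the conclusion holds on both sides. *)

theory Defs
  imports "HOL-Algebra.Algebra"
begin

text \<open>
  The base ring \<open>A\<close> is a type of class \<open>ring\<close>, i.e. an associative ring which need not have an
  identity. Its ideals are sets. Rings with identity other than \<open>A\<close>, and modules over them, are
  structures in the sense of HOL-Algebra.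
\<close>

section \<open>Groupoids\<close>

text \<open>Objects are identified with their identity morphisms, so source and target are morphisms.
  The product \<open>g \<cdot> h\<close> is meaningful only if \<open>src g = tgt h\<close>.\<close>

record 'g groupoid = "'g partial_object" +
  src :: "'g \<Rightarrow> 'g" ("src\<index>")
  tgt :: "'g \<Rightarrow> 'g" ("tgt\<index>")
  gcomp :: "'g \<Rightarrow> 'g \<Rightarrow> 'g" (infixl "\<cdot>\<index>" 70)

locale groupoid =
  fixes G :: "('g, 'k) groupoid_scheme" (structure)
  assumes src_closed: "g \<in> carrier G \<Longrightarrow> src g \<in> carrier G"
    and tgt_closed: "g \<in> carrier G \<Longrightarrow> tgt g \<in> carrier G"
    and src_src: "g \<in> carrier G \<Longrightarrow> src (src g) = src g"
    and tgt_src: "g \<in> carrier G \<Longrightarrow> tgt (src g) = src g"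
    and src_tgt: "g \<in> carrier G \<Longrightarrow> src (tgt g) = tgt g"
    and tgt_tgt: "g \<in> carrier G \<Longrightarrow> tgt (tgt g) = tgt g"
    and comp_closed: "\<lbrakk>g \<in> carrier G; h \<in> carrier G; src g = tgt h\<rbrakk> \<Longrightarrow> g \<cdot> h \<in> carrier G"
    and src_comp: "\<lbrakk>g \<in> carrier G; h \<in> carrier G; src g = tgt h\<rbrakk> \<Longrightarrow> src (g \<cdot> h) = src h"
    and tgt_comp: "\<lbrakk>g \<in> carrier G; h \<in> carrier G; src g = tgt h\<rbrakk> \<Longrightarrow> tgt (g \<cdot> h) = tgt g"
    and comp_assoc: "\<lbrakk>g \<in> carrier G; h \<in> carrier G; k \<in> carrier G; src g = tgt h; src h = tgt k\<rbrakk>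
      \<Longrightarrow> (g \<cdot> h) \<cdot> k = g \<cdot> (h \<cdot> k)"
    and comp_src: "g \<in> carrier G \<Longrightarrow> g \<cdot> src g = g"
    and tgt_comp_id: "g \<in> carrier G \<Longrightarrow> tgt g \<cdot> g = g"
    and invertible: "g \<in> carrier G \<Longrightarrow>
      \<exists>h \<in> carrier G. src h = tgt g \<and> tgt h = src g \<and> h \<cdot> g = src g \<and> g \<cdot> h = tgt g"

definition objects :: "('g, 'k) groupoid_scheme \<Rightarrow> 'g set" where
  "objects G = {y \<in> carrier G. src\<^bsub>G\<^esub> y = y}"

definition ginv :: "('g, 'k) groupoid_scheme \<Rightarrow> 'g \<Rightarrow> 'g" where
  "ginv G g = (THE h. h \<in> carrier G \<and> src\<^bsub>G\<^esub> h = tgt\<^bsub>G\<^esub> g \<and> tgt\<^bsub>G\<^esub> h = src\<^bsub>G\<^esub> g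
     \<and> h \<cdot>\<^bsub>G\<^esub> g = src\<^bsub>G\<^esub> g \<and> g \<cdot>\<^bsub>G\<^esub> h = tgt\<^bsub>G\<^esub> g)"

definition isotropy :: "('g, 'k) groupoid_scheme \<Rightarrow> 'g \<Rightarrow> 'g set" where
  "isotropy G x = {g \<in> carrier G. src\<^bsub>G\<^esub> g = x \<and> tgt\<^bsub>G\<^esub> g = x}"

definition connected_groupoid :: "('g, 'k) groupoid_scheme \<Rightarrow> bool" where
  "connected_groupoid G \<longleftrightarrow> groupoid G \<and>
     (\<forall>y \<in> objects G. \<forall>z \<in> objects G. \<exists>g \<in> carrier G. src\<^bsub>G\<^esub> g = y \<and> tgt\<^bsub>G\<^esub> g = z)"

definition transversal :: "('g, 'k) groupoid_scheme \<Rightarrow> 'g \<Rightarrow> ('g \<Rightarrow> 'g) \<Rightarrow> bool" where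
  "transversal G x \<tau> \<longleftrightarrow>
     (\<forall>y \<in> objects G. \<tau> y \<in> carrier G \<and> src\<^bsub>G\<^esub> (\<tau> y) = x \<and> tgt\<^bsub>G\<^esub> (\<tau> y) = y) \<and> \<tau> x = x"


section \<open>Partial actions on a ring\<close>

text \<open>Ideals of a possibly non-unital subring \<open>B\<close> of the ambient ring; the locale \<open>ideal\<close> of
  HOL-Algebra only covers rings with identity.\<close>

definition ideal_in :: "'a::ring set \<Rightarrow> 'a set \<Rightarrow> bool" where
  "ideal_in I B \<longleftrightarrow> I \<subseteq> B \<and> 0 \<in> I \<and> (\<forall>a \<in> I. \<forall>b \<in> I. a + b \<in> I) \<and> (\<forall>a \<in> I. - a \<in> I) \<and>
     (\<forall>b \<in> B. \<forall>a \<in> I. b * a \<in> I \<and> a * b \<in> I)"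

definition center_of :: "'a::ring set \<Rightarrow> 'a set" where
  "center_of B = {c \<in> B. \<forall>b \<in> B. c * b = b * c}"

definition ring_iso_on :: "'a::ring set \<Rightarrow> 'a set \<Rightarrow> ('a \<Rightarrow> 'a) \<Rightarrow> bool" where
  "ring_iso_on I J f \<longleftrightarrow> bij_betw f I J \<and>
     (\<forall>a \<in> I. \<forall>b \<in> I. f (a + b) = f a + f b \<and> f (a * b) = f a * f b)"

definition internal_direct_sum :: "'i set \<Rightarrow> ('i \<Rightarrow> 'a::ring set) \<Rightarrow> bool" where
  "internal_direct_sum I B \<longleftrightarrow> finite I \<and> (\<forall>a. \<exists>!f. f \<in> Pi\<^sub>E I B \<and> a = (\<Sum>i\<in>I. f i))"

text \<open>\<open>D g\<close> is the ideal \<open>A\<^sub>g\<close>. Each \<open>\<alpha> g\<close> is a total function of which only the restriction to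
  \<open>D (ginv G g)\<close> matters.\<close>

locale partial_action = groupoid G
  for G :: "('g, 'k) groupoid_scheme" (structure) +
  fixes D :: "'g \<Rightarrow> 'a::ring set" and \<alpha> :: "'g \<Rightarrow> 'a \<Rightarrow> 'a"
  assumes ideal_tgt: "g \<in> carrier G \<Longrightarrow> ideal_in (D g) (D (tgt g))"
    and ideal_ring: "g \<in> carrier G \<Longrightarrow> ideal_in (D (tgt g)) UNIV"
    and iso: "g \<in> carrier G \<Longrightarrow> ring_iso_on (D (ginv G g)) (D g) (\<alpha> g)"
    and act_object: "\<lbrakk>y \<in> objects G; a \<in> D y\<rbrakk> \<Longrightarrow> \<alpha> y a = a"
    and act_comp: "\<lbrakk>g \<in> carrier G; h \<in> carrier G; src g = tgt h;
        a \<in> D (ginv G h); \<alpha> h a \<in> D (ginv G g) \<inter> D h\<rbrakk>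
      \<Longrightarrow> a \<in> D (ginv G (g \<cdot> h)) \<and> \<alpha> (g \<cdot> h) a = \<alpha> g (\<alpha> h a)"

text \<open>\<open>e g\<close> is the central idempotent \<open>1\<^sub>g\<close>; it is determined by \<open>D g\<close>, being its identity.\<close>

locale unital_partial_action = partial_action G D \<alpha>
  for G :: "('g, 'k) groupoid_scheme" (structure)
    and D :: "'g \<Rightarrow> 'a::ring set" and \<alpha> :: "'g \<Rightarrow> 'a \<Rightarrow> 'a" +
  fixes e :: "'g \<Rightarrow> 'a"
  assumes e_central: "g \<in> carrier G \<Longrightarrow> e g \<in> center_of UNIV"
    and e_idem: "g \<in> carrier G \<Longrightarrow> e g * e g = e g"
    and D_eq: "g \<in> carrier G \<Longrightarrow> D g = {a * e g | a. True}"

definition group_type_transversal ::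
  "('g, 'k) groupoid_scheme \<Rightarrow> ('g \<Rightarrow> 'a::ring set) \<Rightarrow> 'g \<Rightarrow> ('g \<Rightarrow> 'g) \<Rightarrow> bool" where
  "group_type_transversal G D x \<tau> \<longleftrightarrow> transversal G x \<tau> \<and>
     (\<forall>y \<in> objects G. D (ginv G (\<tau> y)) = D x \<and> D (\<tau> y) = D y)"

definition group_type ::
  "('g, 'k) groupoid_scheme \<Rightarrow> ('g \<Rightarrow> 'a::ring set) \<Rightarrow> ('g \<Rightarrow> 'a \<Rightarrow> 'a) \<Rightarrow> bool" where
  "group_type G D \<alpha> \<longleftrightarrow> partial_action G D \<alpha> \<and> connected_groupoid G \<and>
     (\<exists>x \<in> objects G. \<exists>\<tau>. group_type_transversal G D x \<tau>)"

definition isotropy_trace ::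
  "('g, 'k) groupoid_scheme \<Rightarrow> ('g \<Rightarrow> 'a::ring \<Rightarrow> 'a) \<Rightarrow> ('g \<Rightarrow> 'a) \<Rightarrow> 'g \<Rightarrow> 'a \<Rightarrow> 'a" where
  "isotropy_trace G \<alpha> e x a = (\<Sum>h \<in> isotropy G x. \<alpha> h (a * e (ginv G h)))"


section \<open>The partial skew groupoid ring\<close>

text \<open>The formal sum of the \<open>a\<^sub>g \<delta>\<^sub>g\<close> is the function \<open>g \<mapsto> a\<^sub>g\<close>, extended by \<open>0\<close> outside \<open>G\<close>. The
  sum in the product runs over pairs in the supports, hence is finite. The field \<open>one\<close> is
  meaningful only for finitely many objects.\<close>

definition skew_groupoid_ring ::
  "('g, 'k) groupoid_scheme \<Rightarrow> ('g \<Rightarrow> 'a::ring set) \<Rightarrow> ('g \<Rightarrow> 'a \<Rightarrow> 'a) \<Rightarrow> ('g \<Rightarrow> 'a)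
    \<Rightarrow> ('g \<Rightarrow> 'a) ring" where
  "skew_groupoid_ring G D \<alpha> e =
     \<lparr>carrier = {u. (\<forall>g \<in> carrier G. u g \<in> D g) \<and> (\<forall>g. g \<notin> carrier G \<longrightarrow> u g = 0)
                  \<and> finite {g. u g \<noteq> 0}},
      monoid.mult = (\<lambda>u v k. \<Sum>(g, h) \<in> {(g, h). g \<in> carrier G \<and> h \<in> carrier G \<and> u g \<noteq> 0 \<and> v h \<noteq> 0
                  \<and> src\<^bsub>G\<^esub> g = tgt\<^bsub>G\<^esub> h \<and> g \<cdot>\<^bsub>G\<^esub> h = k}. u g * \<alpha> g (v h * e (ginv G g))),
      one = (\<lambda>g. if g \<in> objects G then e g else 0),
      ring.zero = (\<lambda>g. 0),
      add = (\<lambda>u v g. u g + v g)\<rparr>"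

definition skew_embedding ::
  "('g, 'k) groupoid_scheme \<Rightarrow> ('g \<Rightarrow> 'a::ring) \<Rightarrow> 'a \<Rightarrow> 'g \<Rightarrow> 'a" where
  "skew_embedding G e a = (\<lambda>g. if g \<in> objects G then a * e g else 0)"

definition ring_embedding :: "('a::ring \<Rightarrow> 's) \<Rightarrow> ('s, 'k) ring_scheme \<Rightarrow> bool" where
  "ring_embedding \<phi> S \<longleftrightarrow> inj \<phi> \<and> range \<phi> \<subseteq> carrier S \<and>
     (\<forall>a b. \<phi> (a + b) = \<phi> a \<oplus>\<^bsub>S\<^esub> \<phi> b \<and> \<phi> (a * b) = \<phi> a \<otimes>\<^bsub>S\<^esub> \<phi> b)"


section \<open>Semisimple extensions\<close>

text \<open>The locale \<open>module\<close> of HOL-Algebra requires a commutative ring of scalars. For a right module,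
  \<open>s \<odot>\<^bsub>M\<^esub> m\<close> stands for \<open>m s\<close>. The locale \<open>submodule\<close> does not constrain the scalars and is
  used for both sides.\<close>

locale left_module = S?: ring S + M?: abelian_group M
  for S :: "('s, 'k) ring_scheme" (structure) and M :: "('s, 'm) module" (structure) +
  assumes smult_closed: "\<lbrakk>s \<in> carrier S; m \<in> carrier M\<rbrakk> \<Longrightarrow> s \<odot>\<^bsub>M\<^esub> m \<in> carrier M"
    and smult_l_distr: "\<lbrakk>s \<in> carrier S; t \<in> carrier S; m \<in> carrier M\<rbrakk>
      \<Longrightarrow> (s \<oplus> t) \<odot>\<^bsub>M\<^esub> m = s \<odot>\<^bsub>M\<^esub> m \<oplus>\<^bsub>M\<^esub> t \<odot>\<^bsub>M\<^esub> m"
    and smult_r_distr: "\<lbrakk>s \<in> carrier S; m \<in> carrier M; n \<in> carrier M\<rbrakk>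
      \<Longrightarrow> s \<odot>\<^bsub>M\<^esub> (m \<oplus>\<^bsub>M\<^esub> n) = s \<odot>\<^bsub>M\<^esub> m \<oplus>\<^bsub>M\<^esub> s \<odot>\<^bsub>M\<^esub> n"
    and smult_assoc: "\<lbrakk>s \<in> carrier S; t \<in> carrier S; m \<in> carrier M\<rbrakk>
      \<Longrightarrow> (s \<otimes> t) \<odot>\<^bsub>M\<^esub> m = s \<odot>\<^bsub>M\<^esub> (t \<odot>\<^bsub>M\<^esub> m)"
    and smult_one: "m \<in> carrier M \<Longrightarrow> \<one> \<odot>\<^bsub>M\<^esub> m = m"

locale right_module = S?: ring S + M?: abelian_group M
  for S :: "('s, 'k) ring_scheme" (structure) and M :: "('s, 'm) module" (structure) +
  assumes smult_closed: "\<lbrakk>s \<in> carrier S; m \<in> carrier M\<rbrakk> \<Longrightarrow> s \<odot>\<^bsub>M\<^esub> m \<in> carrier M"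
    and smult_l_distr: "\<lbrakk>s \<in> carrier S; t \<in> carrier S; m \<in> carrier M\<rbrakk>
      \<Longrightarrow> (s \<oplus> t) \<odot>\<^bsub>M\<^esub> m = s \<odot>\<^bsub>M\<^esub> m \<oplus>\<^bsub>M\<^esub> t \<odot>\<^bsub>M\<^esub> m"
    and smult_r_distr: "\<lbrakk>s \<in> carrier S; m \<in> carrier M; n \<in> carrier M\<rbrakk>
      \<Longrightarrow> s \<odot>\<^bsub>M\<^esub> (m \<oplus>\<^bsub>M\<^esub> n) = s \<odot>\<^bsub>M\<^esub> m \<oplus>\<^bsub>M\<^esub> s \<odot>\<^bsub>M\<^esub> n"
    and smult_assoc: "\<lbrakk>s \<in> carrier S; t \<in> carrier S; m \<in> carrier M\<rbrakk>
      \<Longrightarrow> (s \<otimes> t) \<odot>\<^bsub>M\<^esub> m = t \<odot>\<^bsub>M\<^esub> (s \<odot>\<^bsub>M\<^esub> m)"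
    and smult_one: "m \<in> carrier M \<Longrightarrow> \<one> \<odot>\<^bsub>M\<^esub> m = m"

definition has_complement ::
  "('s, 'k) ring_scheme \<Rightarrow> ('s, 'm) module \<Rightarrow> 'm set \<Rightarrow> bool" where
  "has_complement R M N \<longleftrightarrow>
     (\<exists>K. submodule K R M \<and> N \<inter> K = {\<zero>\<^bsub>M\<^esub>} \<and> N <+>\<^bsub>M\<^esub> K = carrier M)"

definition unital_ring_extension :: "'s set \<Rightarrow> ('s, 'k) ring_scheme \<Rightarrow> bool" where
  "unital_ring_extension R S \<longleftrightarrow> ring S \<and> subring R S"

text \<open>The modules range over all structures with elements in the arbitrary type \<open>'m\<close>. The
  \<open>R\<close>-module structure is obtained by shrinking the carrier of the scalars to \<open>R\<close>.\<close>

definition left_semisimple_extension ::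
  "'m itself \<Rightarrow> 's set \<Rightarrow> ('s, 'k) ring_scheme \<Rightarrow> bool" where
  "left_semisimple_extension _ R S \<longleftrightarrow> unital_ring_extension R S \<and>
     (\<forall>(M :: ('s, 'm) module) N. left_module S M \<longrightarrow> submodule N S M \<longrightarrow>
        has_complement (S\<lparr>carrier := R\<rparr>) M N \<longrightarrow> has_complement S M N)"

definition right_semisimple_extension ::
  "'m itself \<Rightarrow> 's set \<Rightarrow> ('s, 'k) ring_scheme \<Rightarrow> bool" where
  "right_semisimple_extension _ R S \<longleftrightarrow> unital_ring_extension R S \<and>
     (\<forall>(M :: ('s, 'm) module) N. right_module S M \<longrightarrow> submodule N S M \<longrightarrow>
        has_complement (S\<lparr>carrier := R\<rparr>) M N \<longrightarrow> has_complement S M N)"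

end

theory Submission
  imports Defs
begin

text \<open>
  The element \<open>c = a\<^sub>x\<close> of hypothesis (i) is central in \<open>A\<close>. The element
  \<open>\<Sum> \<alpha>\<^sub>g(c 1\<^sub>h)\<delta>\<^sub>g \<otimes> 1\<^sub>h\<delta>\<^sub>h\<close>, where \<open>h\<close> is the inverse of \<open>g\<close>,
  summed over all \<open>g\<close> with source \<open>x\<close>, commutes with
  the skew groupoid ring, and multiplying its two factors gives \<open>1\<close>, because \<open>\<alpha>\<close> along \<open>\<tau>\<^sub>y\<close>
  carries the trace identity at \<open>x\<close> to the object \<open>y\<close>. Averaging with this separability element
  turns \<open>A\<close>-linear projections into projections that are linear over the skew groupoid ring.
\<close>

section \<open>Separability and semisimple extensions\<close>

text \<open>For a finite group acting with an element \<open>c\<close> of trace one, the classical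
  element is the sum of g(c)\<delta>_g \<otimes> \<delta>_h with h inverse to g. Over a groupoid,
  the arrows that start at the single object \<open>x\<close> take the place of the group: they are
  permuted well enough by left composition, and they reach every object. The obstacle is partiality:
  applying \<alpha> at h and then at g agrees with \<alpha> at the composite only up to an
  idempotent. All maps are therefore made total by cutting their argument down to the domain, and
  composition holds with an explicit factor \<open>e g\<close> that must be absorbed at each use.
  Centrality of \<open>c\<close> lets coefficients pass it. Along \<tau> the domains and ranges are
  all of A_x and A_y, so nothing of the trace identity is lost on the way from x to y. Biadditive
  balanced maps into an abelian group stand in for the tensor product. Since that group carries no
  scalars here, one and the same element serves left modules and, through the opposite ring, right
  modules.\<close>

definition balanced_map ::
  "'s set \<Rightarrow> ('s, 'k) ring_scheme \<Rightarrow> ('b, 'c) ring_scheme \<Rightarrow> ('s \<Rightarrow> 's \<Rightarrow> 'b) \<Rightarrow> bool" where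
  "balanced_map R S M \<beta> \<longleftrightarrow>
     (\<forall>p \<in> carrier S. \<forall>q \<in> carrier S. \<beta> p q \<in> carrier M) \<and>
     (\<forall>p \<in> carrier S. \<forall>p' \<in> carrier S. \<forall>q \<in> carrier S. \<beta> (p \<oplus>\<^bsub>S\<^esub> p') q = \<beta> p q \<oplus>\<^bsub>M\<^esub> \<beta> p' q) \<and>
     (\<forall>p \<in> carrier S. \<forall>q \<in> carrier S. \<forall>q' \<in> carrier S. \<beta> p (q \<oplus>\<^bsub>S\<^esub> q') = \<beta> p q \<oplus>\<^bsub>M\<^esub> \<beta> p q') \<and>
     (\<forall>p \<in> carrier S. \<forall>r \<in> R. \<forall>q \<in> carrier S. \<beta> (p \<otimes>\<^bsub>S\<^esub> r) q = \<beta> p (r \<otimes>\<^bsub>S\<^esub> q))"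

text \<open>The last clause says that \<open>\<Sum> p\<^sub>i \<otimes> q\<^sub>i\<close> commutes with every element of \<open>S\<close> in
  \<open>S \<otimes>\<^sub>R S\<close>, tested on the homomorphisms from the tensor product to \<open>M\<close>.\<close>

definition separability_system ::
  "'s set \<Rightarrow> ('s, 'k) ring_scheme \<Rightarrow> ('b, 'c) ring_scheme \<Rightarrow> 'i set \<Rightarrow> ('i \<Rightarrow> 's) \<Rightarrow> ('i \<Rightarrow> 's) \<Rightarrow> bool"
where
  "separability_system R S M I p q \<longleftrightarrow>
     finite I \<and> p \<in> I \<rightarrow> carrier S \<and> q \<in> I \<rightarrow> carrier S \<and>
     (\<Oplus>\<^bsub>S\<^esub>i\<in>I. p i \<otimes>\<^bsub>S\<^esub> q i) = \<one>\<^bsub>S\<^esub> \<and>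
     (\<forall>\<beta>. balanced_map R S M \<beta> \<longrightarrow> (\<forall>s \<in> carrier S.
        (\<Oplus>\<^bsub>M\<^esub>i\<in>I. \<beta> (s \<otimes>\<^bsub>S\<^esub> p i) (q i)) = (\<Oplus>\<^bsub>M\<^esub>i\<in>I. \<beta> (p i) (q i \<otimes>\<^bsub>S\<^esub> s))))"

lemma separability_system_casimir:
  assumes "separability_system R S M I p q" "balanced_map R S M \<beta>" "s \<in> carrier S"
  shows "(\<Oplus>\<^bsub>M\<^esub>i\<in>I. \<beta> (s \<otimes>\<^bsub>S\<^esub> p i) (q i)) = (\<Oplus>\<^bsub>M\<^esub>i\<in>I. \<beta> (p i) (q i \<otimes>\<^bsub>S\<^esub> s))"
  using assms unfolding separability_system_def by blast

section \<open>Additive maps, finite sums and balanced maps\<close>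

lemma (in abelian_monoid) finsum_hom:
  assumes "abelian_monoid H" "finite I" "f \<in> I \<rightarrow> carrier G"
    and "\<And>a. a \<in> carrier G \<Longrightarrow> h a \<in> carrier H"
    and "h \<zero> = \<zero>\<^bsub>H\<^esub>"
    and "\<And>a b. a \<in> carrier G \<Longrightarrow> b \<in> carrier G \<Longrightarrow> h (a \<oplus> b) = h a \<oplus>\<^bsub>H\<^esub> h b"
  shows "h (\<Oplus>i\<in>I. f i) = (\<Oplus>\<^bsub>H\<^esub>i\<in>I. h (f i))"
proof -
  interpret H: abelian_monoid H by fact
  show ?thesis
    using assms(2,3)
  proof (induction I rule: finite_induct)
    case empty
    show ?case using assms(5) by simp
  next
    case (insert i F)
    then have "f i \<in> carrier G" "f \<in> F \<rightarrow> carrier G" by auto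
    moreover from this have "(\<lambda>i. h (f i)) \<in> F \<rightarrow> carrier H" "h (f i) \<in> carrier H"
      using assms(4) by auto
    ultimately show ?case
      using insert assms(6) by (simp add: finsum_insert H.finsum_insert finsum_closed)
  qed
qed

lemma group_hom_zero:
  assumes "abelian_group A" "abelian_group B"
    and "\<And>a. a \<in> carrier A \<Longrightarrow> h a \<in> carrier B"
    and "\<And>a b. a \<in> carrier A \<Longrightarrow> b \<in> carrier A \<Longrightarrow> h (a \<oplus>\<^bsub>A\<^esub> b) = h a \<oplus>\<^bsub>B\<^esub> h b"
  shows "h \<zero>\<^bsub>A\<^esub> = \<zero>\<^bsub>B\<^esub>"
proof -
  interpret A: abelian_group A by fact
  interpret B: abelian_group B by fact
  have "h \<zero>\<^bsub>A\<^esub> \<oplus>\<^bsub>B\<^esub> h \<zero>\<^bsub>A\<^esub> = h \<zero>\<^bsub>A\<^esub> \<oplus>\<^bsub>B\<^esub> \<zero>\<^bsub>B\<^esub>"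
    using assms(4)[of "\<zero>\<^bsub>A\<^esub>" "\<zero>\<^bsub>A\<^esub>"] assms(3)[of "\<zero>\<^bsub>A\<^esub>"] by simp
  then show ?thesis using assms(3) by (metis A.zero_closed B.add.l_cancel B.zero_closed)
qed

lemma balanced_mapD:
  assumes "balanced_map R S M \<beta>" "u \<in> carrier S" "v \<in> carrier S"
  shows "\<beta> u v \<in> carrier M"
    and "w \<in> carrier S \<Longrightarrow> \<beta> (u \<oplus>\<^bsub>S\<^esub> w) v = \<beta> u v \<oplus>\<^bsub>M\<^esub> \<beta> w v"
    and "w \<in> carrier S \<Longrightarrow> \<beta> u (v \<oplus>\<^bsub>S\<^esub> w) = \<beta> u v \<oplus>\<^bsub>M\<^esub> \<beta> u w"
    and "r \<in> R \<Longrightarrow> \<beta> (u \<otimes>\<^bsub>S\<^esub> r) v = \<beta> u (r \<otimes>\<^bsub>S\<^esub> v)"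
  using assms unfolding balanced_map_def by blast+

lemma balanced_map_zero:
  assumes "balanced_map R S M \<beta>" "abelian_group S" "abelian_group M" "u \<in> carrier S"
  shows "\<beta> \<zero>\<^bsub>S\<^esub> u = \<zero>\<^bsub>M\<^esub>" "\<beta> u \<zero>\<^bsub>S\<^esub> = \<zero>\<^bsub>M\<^esub>"
proof -
  note \<beta> = balanced_mapD[OF assms(1)]
  show "\<beta> \<zero>\<^bsub>S\<^esub> u = \<zero>\<^bsub>M\<^esub>"
    by (rule group_hom_zero[OF assms(2,3)]) (simp_all add: \<beta>(1,2) assms(4))
  show "\<beta> u \<zero>\<^bsub>S\<^esub> = \<zero>\<^bsub>M\<^esub>"
    by (rule group_hom_zero[OF assms(2,3)]) (simp_all add: \<beta>(1,3) assms(4))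
qed

section \<open>Modules, complements and averaged projections\<close>

context left_module
begin

lemma smult_zero_right: "s \<in> carrier S \<Longrightarrow> s \<odot>\<^bsub>M\<^esub> \<zero>\<^bsub>M\<^esub> = \<zero>\<^bsub>M\<^esub>"
  by (rule group_hom_zero[of M M "\<lambda>m. s \<odot>\<^bsub>M\<^esub> m"])
    (auto simp: M.abelian_group_axioms smult_closed smult_r_distr)

lemma finsum_smult_left:
  assumes "finite I" "f \<in> I \<rightarrow> carrier S" "m \<in> carrier M"
  shows "(\<Oplus>i\<in>I. f i) \<odot>\<^bsub>M\<^esub> m = (\<Oplus>\<^bsub>M\<^esub>i\<in>I. f i \<odot>\<^bsub>M\<^esub> m)"
proof (rule S.finsum_hom[where h = "\<lambda>s. s \<odot>\<^bsub>M\<^esub> m"])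
  show "\<zero> \<odot>\<^bsub>M\<^esub> m = \<zero>\<^bsub>M\<^esub>"
    by (rule group_hom_zero[of S M])
      (use assms in \<open>auto simp: M.abelian_group_axioms S.abelian_group_axioms smult_closed smult_l_distr\<close>)
qed (use assms in \<open>auto simp: M.abelian_monoid_axioms smult_closed smult_l_distr\<close>)

lemma finsum_smult_right:
  assumes "finite I" "f \<in> I \<rightarrow> carrier M" "s \<in> carrier S"
  shows "s \<odot>\<^bsub>M\<^esub> (\<Oplus>\<^bsub>M\<^esub>i\<in>I. f i) = (\<Oplus>\<^bsub>M\<^esub>i\<in>I. s \<odot>\<^bsub>M\<^esub> f i)"
  by (rule M.finsum_hom[where h = "\<lambda>m. s \<odot>\<^bsub>M\<^esub> m"])
    (use assms in \<open>auto simp: M.abelian_monoid_axioms smult_closed smult_r_distr smult_zero_right\<close>)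

lemma submoduleI:
  assumes "H \<subseteq> carrier M" "\<zero>\<^bsub>M\<^esub> \<in> H"
    and "\<And>a b. a \<in> H \<Longrightarrow> b \<in> H \<Longrightarrow> a \<oplus>\<^bsub>M\<^esub> b \<in> H"
    and "\<And>a. a \<in> H \<Longrightarrow> \<ominus>\<^bsub>M\<^esub> a \<in> H"
    and "\<And>s a. s \<in> carrier S \<Longrightarrow> a \<in> H \<Longrightarrow> s \<odot>\<^bsub>M\<^esub> a \<in> H"
  shows "submodule H S M"
  by (intro submodule.intro subgroup.intro submodule_axioms.intro)
    (use assms in \<open>simp_all add: a_inv_def\<close>)

end

text \<open>This is the projection along the complement \<open>K\<close>. The scalar structure
  \<open>R\<close> is kept arbitrary so that the lemma can be applied to \<open>S\<close> with its
  carrier shrunk to a subring.\<close>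

lemma has_complement_projection:
  assumes "abelian_group M" "submodule N R M" "has_complement R M N"
    and smult: "\<And>r m n. r \<in> carrier R \<Longrightarrow> m \<in> carrier M \<Longrightarrow> n \<in> carrier M
      \<Longrightarrow> r \<odot>\<^bsub>M\<^esub> (m \<oplus>\<^bsub>M\<^esub> n) = r \<odot>\<^bsub>M\<^esub> m \<oplus>\<^bsub>M\<^esub> r \<odot>\<^bsub>M\<^esub> n"
  shows "\<exists>\<pi>. (\<forall>m \<in> carrier M. \<pi> m \<in> N) \<and> (\<forall>n \<in> N. \<pi> n = n)
    \<and> (\<forall>m \<in> carrier M. \<forall>n \<in> carrier M. \<pi> (m \<oplus>\<^bsub>M\<^esub> n) = \<pi> m \<oplus>\<^bsub>M\<^esub> \<pi> n)
    \<and> (\<forall>r \<in> carrier R. \<forall>m \<in> carrier M. \<pi> (r \<odot>\<^bsub>M\<^esub> m) = r \<odot>\<^bsub>M\<^esub> \<pi> m)"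
proof -
  interpret M: abelian_group M by fact
  from assms(3) obtain K where K: "submodule K R M" "N \<inter> K = {\<zero>\<^bsub>M\<^esub>}"
    and NK: "N <+>\<^bsub>M\<^esub> K = carrier M"
    by (auto simp: has_complement_def)
  interpret N: submodule N R M by fact
  interpret K: submodule K R M by fact
  have Nc: "n \<in> carrier M" if "n \<in> N" for n using N.subset that by auto
  have Kc: "n \<in> carrier M" if "n \<in> K" for n using K.subset that by auto
  have Nadd: "a \<oplus>\<^bsub>M\<^esub> b \<in> N" if "a \<in> N" "b \<in> N" for a b using N.m_closed that by simp
  have Kadd: "a \<oplus>\<^bsub>M\<^esub> b \<in> K" if "a \<in> K" "b \<in> K" for a b using K.m_closed that by simp
  have Nneg: "\<ominus>\<^bsub>M\<^esub> a \<in> N" if "a \<in> N" for a using N.m_inv_closed that by (simp add: a_inv_def)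
  have Kneg: "\<ominus>\<^bsub>M\<^esub> a \<in> K" if "a \<in> K" for a using K.m_inv_closed that by (simp add: a_inv_def)
  have N0: "\<zero>\<^bsub>M\<^esub> \<in> N" and K0: "\<zero>\<^bsub>M\<^esub> \<in> K" using K(2) by auto
  define \<pi> where "\<pi> m = (SOME n. n \<in> N \<and> (\<exists>k \<in> K. m = n \<oplus>\<^bsub>M\<^esub> k))" for m
  have ex: "\<exists>n. n \<in> N \<and> (\<exists>k \<in> K. m = n \<oplus>\<^bsub>M\<^esub> k)" if "m \<in> carrier M" for m
    using that unfolding NK[symmetric] by (auto simp: set_add_def')
  have \<pi>: "\<pi> m \<in> N \<and> (\<exists>k \<in> K. m = \<pi> m \<oplus>\<^bsub>M\<^esub> k)" if "m \<in> carrier M" for m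
    unfolding \<pi>_def by (rule someI_ex[OF ex[OF that]])
  have \<pi>N: "\<pi> m \<in> N" if "m \<in> carrier M" for m using \<pi>[OF that] by (rule conjunct1)
  have unique: "n = n'" if "n \<in> N" "n' \<in> N" "k \<in> K" "k' \<in> K" "n \<oplus>\<^bsub>M\<^esub> k = n' \<oplus>\<^bsub>M\<^esub> k'" for n n' k k'
  proof -
    have c: "n \<in> carrier M" "n' \<in> carrier M" "k \<in> carrier M" "k' \<in> carrier M"
      using that Nc Kc by auto
    have "n = (n \<oplus>\<^bsub>M\<^esub> k) \<ominus>\<^bsub>M\<^esub> k" using c by (simp add: M.minus_eq M.a_assoc M.r_neg)
    also have "\<dots> = n' \<oplus>\<^bsub>M\<^esub> (k' \<ominus>\<^bsub>M\<^esub> k)" unfolding that(5) using c by (simp add: M.minus_eq M.a_assoc)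
    finally have "n \<ominus>\<^bsub>M\<^esub> n' = \<ominus>\<^bsub>M\<^esub> n' \<oplus>\<^bsub>M\<^esub> (n' \<oplus>\<^bsub>M\<^esub> (k' \<ominus>\<^bsub>M\<^esub> k))"
      using c by (simp add: M.minus_eq M.a_comm)
    then have eq: "n \<ominus>\<^bsub>M\<^esub> n' = k' \<ominus>\<^bsub>M\<^esub> k" using c by (simp add: M.r_neg1)
    have "n \<ominus>\<^bsub>M\<^esub> n' \<in> N" using that Nadd Nneg by (simp add: M.minus_eq)
    moreover have "k' \<ominus>\<^bsub>M\<^esub> k \<in> K" using that Kadd Kneg by (simp add: M.minus_eq)
    ultimately have "n \<ominus>\<^bsub>M\<^esub> n' = \<zero>\<^bsub>M\<^esub>" using eq K(2) by auto
    then have "\<ominus>\<^bsub>M\<^esub> (\<ominus>\<^bsub>M\<^esub> n') = n" using c by (intro M.minus_equality) (auto simp: M.minus_eq)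
    then show ?thesis using c by simp
  qed
  \<comment> \<open>By uniqueness, any decomposition of \<open>m\<close> computes the value chosen
    by \<open>SOME\<close>; each property of \<open>\<pi>\<close> below reduces to exhibiting a
    decomposition.\<close>
  have \<pi>I: "\<pi> m = n" if "m = n \<oplus>\<^bsub>M\<^esub> k" "n \<in> N" "k \<in> K" for m n k
  proof -
    have "m \<in> carrier M" using that Nc Kc by auto
    then obtain k' where "k' \<in> K" "m = \<pi> m \<oplus>\<^bsub>M\<^esub> k'" "\<pi> m \<in> N" using \<pi> by blast
    with that show ?thesis by (intro unique[of "\<pi> m" n k' k]) simp_all
  qed
  show ?thesis
  proof (intro exI[of _ \<pi>] conjI ballI)
    show "\<pi> m \<in> N" if "m \<in> carrier M" for m using that by (rule \<pi>N)
    show "\<pi> n = n" if "n \<in> N" for n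
      by (rule \<pi>I[of _ _ "\<zero>\<^bsub>M\<^esub>"]) (use that Nc K0 in auto)
    show "\<pi> (m \<oplus>\<^bsub>M\<^esub> n) = \<pi> m \<oplus>\<^bsub>M\<^esub> \<pi> n" if mn: "m \<in> carrier M" "n \<in> carrier M" for m n
    proof -
      obtain k l where kl: "k \<in> K" "m = \<pi> m \<oplus>\<^bsub>M\<^esub> k" "l \<in> K" "n = \<pi> n \<oplus>\<^bsub>M\<^esub> l"
        using \<pi>[OF mn(1)] \<pi>[OF mn(2)] by (elim conjE bexE)
      have c: "\<pi> m \<in> carrier M" "\<pi> n \<in> carrier M" "k \<in> carrier M" "l \<in> carrier M"
        using \<pi>N mn Nc Kc kl(1,3) by auto
      have "m \<oplus>\<^bsub>M\<^esub> n = (\<pi> m \<oplus>\<^bsub>M\<^esub> k) \<oplus>\<^bsub>M\<^esub> (\<pi> n \<oplus>\<^bsub>M\<^esub> l)"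
        by (rule arg_cong2[where f = "(\<oplus>\<^bsub>M\<^esub>)", OF kl(2,4)])
      also have "\<dots> = (\<pi> m \<oplus>\<^bsub>M\<^esub> \<pi> n) \<oplus>\<^bsub>M\<^esub> (k \<oplus>\<^bsub>M\<^esub> l)"
        using c by (simp add: M.a_ac)
      finally show ?thesis
        by (rule \<pi>I) (use \<pi>N mn kl(1,3) Nadd Kadd in auto)
    qed
    show "\<pi> (r \<odot>\<^bsub>M\<^esub> m) = r \<odot>\<^bsub>M\<^esub> \<pi> m" if r: "r \<in> carrier R" and m: "m \<in> carrier M" for r m
    proof -
      obtain k where k: "k \<in> K" "m = \<pi> m \<oplus>\<^bsub>M\<^esub> k" using \<pi>[OF m] by (elim conjE bexE)
      have "r \<odot>\<^bsub>M\<^esub> m = r \<odot>\<^bsub>M\<^esub> (\<pi> m \<oplus>\<^bsub>M\<^esub> k)"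
        by (rule arg_cong[where f = "\<lambda>z. r \<odot>\<^bsub>M\<^esub> z", OF k(2)])
      also have "\<dots> = r \<odot>\<^bsub>M\<^esub> \<pi> m \<oplus>\<^bsub>M\<^esub> r \<odot>\<^bsub>M\<^esub> k"
        using r m k(1) \<pi>N Nc Kc smult by auto
      finally show ?thesis
        by (rule \<pi>I) (use r m k(1) \<pi>N N.smult_closed K.smult_closed in auto)
    qed
  qed
qed

text \<open>Maschke averaging: an \<open>R\<close>-linear projection \<open>\<pi>\<close> onto \<open>N\<close> yields the \<open>S\<close>-linear
  projection \<open>m \<mapsto> \<Sum> p\<^sub>i \<pi>(q\<^sub>i m)\<close>.\<close>

lemma (in left_module) has_complement_if_separable:
  assumes sep: "separability_system R S M I p q"
    and R: "R \<subseteq> carrier S"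
    and N: "submodule N S M"
    and compl: "has_complement (S\<lparr>carrier := R\<rparr>) M N"
  shows "has_complement S M N"
proof -
  interpret N: submodule N S M by fact
  have Nc: "n \<in> carrier M" if "n \<in> N" for n using N.subset that by auto
  have Nadd: "a \<oplus>\<^bsub>M\<^esub> b \<in> N" if "a \<in> N" "b \<in> N" for a b using N.m_closed that by simp
  have N0: "\<zero>\<^bsub>M\<^esub> \<in> N" using N.one_closed by simp
  have NR: "submodule N (S\<lparr>carrier := R\<rparr>) M"
    by (rule submodule.intro[OF N.subgroup_axioms], rule submodule_axioms.intro)
      (simp add: N.smult_closed subsetD[OF R])
  have "r \<odot>\<^bsub>M\<^esub> (m \<oplus>\<^bsub>M\<^esub> n) = r \<odot>\<^bsub>M\<^esub> m \<oplus>\<^bsub>M\<^esub> r \<odot>\<^bsub>M\<^esub> n"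
    if "r \<in> carrier (S\<lparr>carrier := R\<rparr>)" "m \<in> carrier M" "n \<in> carrier M" for r m n
    using that by (simp add: smult_r_distr subsetD[OF R])
  from has_complement_projection[OF M.abelian_group_axioms NR compl this, simplified]
  obtain \<pi> where \<pi>:
    "(\<forall>m \<in> carrier M. \<pi> m \<in> N) \<and> (\<forall>n \<in> N. \<pi> n = n)
      \<and> (\<forall>m \<in> carrier M. \<forall>n \<in> carrier M. \<pi> (m \<oplus>\<^bsub>M\<^esub> n) = \<pi> m \<oplus>\<^bsub>M\<^esub> \<pi> n)
      \<and> (\<forall>r \<in> R. \<forall>m \<in> carrier M. \<pi> (r \<odot>\<^bsub>M\<^esub> m) = r \<odot>\<^bsub>M\<^esub> \<pi> m)"
    by (elim exE)
  have \<pi>N: "\<pi> m \<in> N" if "m \<in> carrier M" for m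
    using \<pi> that by blast
  have \<pi>id: "\<pi> n = n" if "n \<in> N" for n
    using \<pi> that by blast
  have \<pi>add: "\<pi> (m \<oplus>\<^bsub>M\<^esub> n) = \<pi> m \<oplus>\<^bsub>M\<^esub> \<pi> n" if "m \<in> carrier M" "n \<in> carrier M" for m n
    using \<pi> that by blast
  have \<pi>R: "\<pi> (r \<odot>\<^bsub>M\<^esub> m) = r \<odot>\<^bsub>M\<^esub> \<pi> m" if "r \<in> R" "m \<in> carrier M" for r m
    using \<pi> that by simp
  have fin: "finite I" and one: "(\<Oplus>i\<in>I. p i \<otimes> q i) = \<one>"
    and pI: "p \<in> I \<rightarrow> carrier S" and qI: "q \<in> I \<rightarrow> carrier S"
    using sep by (simp_all only: separability_system_def)
  have p: "p i \<in> carrier S" and q: "q i \<in> carrier S" if "i \<in> I" for i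
    using that pI qI by auto
  have casimir: "(\<Oplus>\<^bsub>M\<^esub>i\<in>I. \<beta> (s \<otimes> p i) (q i)) = (\<Oplus>\<^bsub>M\<^esub>i\<in>I. \<beta> (p i) (q i \<otimes> s))"
    if "balanced_map R S M \<beta>" "s \<in> carrier S" for \<beta> s
    using separability_system_casimir[OF sep that] .
  have \<pi>c: "\<pi> m \<in> carrier M" if "m \<in> carrier M" for m using \<pi>N Nc that by blast
  define \<rho> where "\<rho> m = (\<Oplus>\<^bsub>M\<^esub>i\<in>I. p i \<odot>\<^bsub>M\<^esub> \<pi> (q i \<odot>\<^bsub>M\<^esub> m))" for m
  have term_N: "p i \<odot>\<^bsub>M\<^esub> \<pi> (q i \<odot>\<^bsub>M\<^esub> m) \<in> N" if "i \<in> I" "m \<in> carrier M" for i m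
    using that p q \<pi>N smult_closed N.smult_closed by auto
  have finsum_N: "(\<Oplus>\<^bsub>M\<^esub>i\<in>J. f i) \<in> N" if "finite J" "f \<in> J \<rightarrow> N" for J :: "'d set" and f
    using that
  proof (induction J rule: finite_induct)
    case (insert i F)
    then show ?case
      by (subst M.finsum_insert) (auto simp: Pi_iff Nc Nadd)
  qed (simp add: N0)
  have \<rho>N: "\<rho> m \<in> N" if "m \<in> carrier M" for m
    unfolding \<rho>_def by (rule finsum_N) (use fin term_N that in auto)
  have \<rho>c: "\<rho> m \<in> carrier M" if "m \<in> carrier M" for m using \<rho>N Nc that by blast
  have \<rho>add: "\<rho> (m \<oplus>\<^bsub>M\<^esub> n) = \<rho> m \<oplus>\<^bsub>M\<^esub> \<rho> n" if "m \<in> carrier M" "n \<in> carrier M" for m n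
  proof -
    have "\<rho> (m \<oplus>\<^bsub>M\<^esub> n) = (\<Oplus>\<^bsub>M\<^esub>i\<in>I. p i \<odot>\<^bsub>M\<^esub> \<pi> (q i \<odot>\<^bsub>M\<^esub> m) \<oplus>\<^bsub>M\<^esub> p i \<odot>\<^bsub>M\<^esub> \<pi> (q i \<odot>\<^bsub>M\<^esub> n))"
      unfolding \<rho>_def
      by (rule M.finsum_cong')
        (use that p q in \<open>auto simp: smult_r_distr \<pi>add smult_closed \<pi>c\<close>)
    also have "\<dots> = \<rho> m \<oplus>\<^bsub>M\<^esub> \<rho> n"
      unfolding \<rho>_def
      by (rule M.finsum_addf) (use that p q in \<open>auto simp: smult_closed \<pi>c\<close>)
    finally show ?thesis .
  qed
  have \<rho>smult: "\<rho> (s \<odot>\<^bsub>M\<^esub> m) = s \<odot>\<^bsub>M\<^esub> \<rho> m" if sm: "s \<in> carrier S" "m \<in> carrier M" for s m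
  proof -
    \<comment> \<open>With \<open>m\<close> fixed, \<open>R\<close>-linearity of
      \<open>\<pi>\<close> is exactly the balancing condition for \<open>\<beta>\<close>. The
      Casimir identity then carries \<open>s\<close> from the right of \<open>q i\<close> to the
      left of \<open>p i\<close>, that is, out of \<open>\<rho>\<close>.\<close>
    define \<beta> where "\<beta> u v = u \<odot>\<^bsub>M\<^esub> \<pi> (v \<odot>\<^bsub>M\<^esub> m)" for u v
    have "balanced_map R S M \<beta>"
      unfolding balanced_map_def \<beta>_def using R sm(2)
      by (auto simp: smult_closed \<pi>c smult_l_distr smult_r_distr \<pi>add \<pi>R smult_assoc subset_iff)
    from casimir[OF this sm(1)]
    have "(\<Oplus>\<^bsub>M\<^esub>i\<in>I. (s \<otimes> p i) \<odot>\<^bsub>M\<^esub> \<pi> (q i \<odot>\<^bsub>M\<^esub> m)) = (\<Oplus>\<^bsub>M\<^esub>i\<in>I. p i \<odot>\<^bsub>M\<^esub> \<pi> ((q i \<otimes> s) \<odot>\<^bsub>M\<^esub> m))"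
      by (simp add: \<beta>_def)
    moreover have "(\<Oplus>\<^bsub>M\<^esub>i\<in>I. p i \<odot>\<^bsub>M\<^esub> \<pi> ((q i \<otimes> s) \<odot>\<^bsub>M\<^esub> m)) = \<rho> (s \<odot>\<^bsub>M\<^esub> m)"
      unfolding \<rho>_def
      by (rule M.finsum_cong') (use sm p q in \<open>auto simp: smult_assoc smult_closed \<pi>c\<close>)
    moreover have "s \<odot>\<^bsub>M\<^esub> \<rho> m = (\<Oplus>\<^bsub>M\<^esub>i\<in>I. s \<odot>\<^bsub>M\<^esub> (p i \<odot>\<^bsub>M\<^esub> \<pi> (q i \<odot>\<^bsub>M\<^esub> m)))"
      unfolding \<rho>_def
      by (rule finsum_smult_right) (use sm p q fin in \<open>auto simp: smult_closed \<pi>c\<close>)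
    moreover have "\<dots> = (\<Oplus>\<^bsub>M\<^esub>i\<in>I. (s \<otimes> p i) \<odot>\<^bsub>M\<^esub> \<pi> (q i \<odot>\<^bsub>M\<^esub> m))"
      by (rule M.finsum_cong') (use sm p q in \<open>auto simp: smult_assoc smult_closed \<pi>c\<close>)
    ultimately show ?thesis by simp
  qed
  have \<rho>id: "\<rho> n = n" if n: "n \<in> N" for n
  proof -
    \<comment> \<open>Each \<open>q i\<close> maps \<open>n\<close> into \<open>N\<close>, where
      \<open>\<pi>\<close> is the identity; what remains is the sum of the
      \<open>p i \<otimes> q i\<close>, which is 1.\<close>
    have "\<rho> n = (\<Oplus>\<^bsub>M\<^esub>i\<in>I. (p i \<otimes> q i) \<odot>\<^bsub>M\<^esub> n)"
      unfolding \<rho>_def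
      by (rule M.finsum_cong')
        (use n p q in \<open>auto simp: smult_assoc \<pi>id N.smult_closed smult_closed Nc\<close>)
    also have "\<dots> = n"
      using finsum_smult_left[of I "\<lambda>i. p i \<otimes> q i" n] n p q fin one
      by (simp add: Pi_iff Nc smult_one)
    finally show ?thesis .
  qed
  have \<rho>0: "\<rho> \<zero>\<^bsub>M\<^esub> = \<zero>\<^bsub>M\<^esub>" using \<rho>id N0 by blast
  have \<rho>neg: "\<rho> (\<ominus>\<^bsub>M\<^esub> m) = \<ominus>\<^bsub>M\<^esub> \<rho> m" if "m \<in> carrier M" for m
  proof -
    have "\<rho> (\<ominus>\<^bsub>M\<^esub> m) \<oplus>\<^bsub>M\<^esub> \<rho> m = \<zero>\<^bsub>M\<^esub>"
      using \<rho>add[of "\<ominus>\<^bsub>M\<^esub> m" m] that by (simp add: M.l_neg \<rho>0)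
    from M.minus_equality[OF this] show ?thesis using \<rho>c that by simp
  qed
  \<comment> \<open>The complement is the kernel of \<open>\<rho>\<close>: since
    \<open>\<rho>\<close> takes values in \<open>N\<close> and fixes \<open>N\<close>, it splits
    \<open>m\<close> into \<open>\<rho> m\<close> and a remainder killed by
    \<open>\<rho>\<close>.\<close>
  define K where "K = {m \<in> carrier M. \<rho> m = \<zero>\<^bsub>M\<^esub>}"
  have "submodule K S M"
    by (rule submoduleI)
      (simp_all add: K_def subset_iff \<rho>0 \<rho>add \<rho>neg \<rho>smult smult_closed smult_zero_right)
  moreover have "N \<inter> K = {\<zero>\<^bsub>M\<^esub>}"
  proof (intro equalityI subsetI)
    fix m assume "m \<in> N \<inter> K"
    then have "m \<in> N" "\<rho> m = \<zero>\<^bsub>M\<^esub>" by (simp_all add: K_def)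
    then show "m \<in> {\<zero>\<^bsub>M\<^esub>}" using \<rho>id[of m] by simp
  qed (simp add: K_def \<rho>0 N0)
  moreover have "N <+>\<^bsub>M\<^esub> K = carrier M"
  proof
    show "N <+>\<^bsub>M\<^esub> K \<subseteq> carrier M" by (auto simp: set_add_def' K_def dest: Nc)
    show "carrier M \<subseteq> N <+>\<^bsub>M\<^esub> K"
    proof
      fix m assume m: "m \<in> carrier M"
      have "\<rho> (m \<ominus>\<^bsub>M\<^esub> \<rho> m) = \<zero>\<^bsub>M\<^esub>"
        using m \<rho>id[OF \<rho>N[OF m]] by (simp add: M.minus_eq \<rho>add \<rho>neg \<rho>c M.r_neg)
      then have K: "m \<ominus>\<^bsub>M\<^esub> \<rho> m \<in> K" using m \<rho>c by (simp add: K_def)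
      have "m = \<rho> m \<oplus>\<^bsub>M\<^esub> (m \<ominus>\<^bsub>M\<^esub> \<rho> m)"
        using m \<rho>c[OF m] by (simp add: M.minus_eq M.a_comm[of m "\<ominus>\<^bsub>M\<^esub> \<rho> m"] M.r_neg2)
      then have "m \<in> {\<rho> m \<oplus>\<^bsub>M\<^esub> (m \<ominus>\<^bsub>M\<^esub> \<rho> m)}" by (simp only: singleton_iff)
      then show "m \<in> N <+>\<^bsub>M\<^esub> K"
        unfolding set_add_def' by (intro UN_I[OF \<rho>N[OF m]] UN_I[OF K])
    qed
  qed
  ultimately show ?thesis unfolding has_complement_def by blast
qed

section \<open>Right modules as left modules over the opposite ring\<close>

definition opposite_ring :: "('s, 'k) ring_scheme \<Rightarrow> ('s, 'k) ring_scheme" where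
  "opposite_ring S = S\<lparr>monoid.mult := \<lambda>a b. b \<otimes>\<^bsub>S\<^esub> a\<rparr>"

lemma opposite_ring_simps [simp]:
  "carrier (opposite_ring S) = carrier S"
  "a \<otimes>\<^bsub>opposite_ring S\<^esub> b = b \<otimes>\<^bsub>S\<^esub> a"
  "\<one>\<^bsub>opposite_ring S\<^esub> = \<one>\<^bsub>S\<^esub>"
  "\<zero>\<^bsub>opposite_ring S\<^esub> = \<zero>\<^bsub>S\<^esub>"
  "a \<oplus>\<^bsub>opposite_ring S\<^esub> b = a \<oplus>\<^bsub>S\<^esub> b"
  "finsum (opposite_ring S) = finsum S"
  by (simp_all add: opposite_ring_def finsum_def fun_eq_iff)

lemma ring_opposite_ring:
  assumes "ring S" shows "ring (opposite_ring S)"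
proof -
  interpret ring S by fact
  show ?thesis
  proof (rule ringI)
    show "abelian_group (opposite_ring S)"
    proof (rule abelian_groupI)
      show "\<exists>b \<in> carrier (opposite_ring S). b \<oplus>\<^bsub>opposite_ring S\<^esub> a = \<zero>\<^bsub>opposite_ring S\<^esub>"
        if "a \<in> carrier (opposite_ring S)" for a
        using that by (intro bexI[of _ "\<ominus>\<^bsub>S\<^esub> a"]) (simp_all add: l_neg)
    qed (simp_all add: a_ac)
    show "monoid (opposite_ring S)"
      by (rule monoidI) (auto simp: m_assoc)
  qed (auto simp: l_distr r_distr)
qed

lemma left_module_opposite_ring:
  assumes "right_module S M" shows "left_module (opposite_ring S) M"
proof -
  interpret right_module S M by fact
  show ?thesis
    by (intro left_module.intro left_module_axioms.intro ring_opposite_ring S.ring_axioms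
        M.abelian_group_axioms)
      (auto simp: smult_closed smult_l_distr smult_r_distr smult_assoc smult_one)
qed

text \<open>Exchanging the two arguments of a balanced map over the opposite ring gives a balanced
  map over \<open>S\<close>. The Casimir identity is thereby read backwards with \<open>p\<close>
  and \<open>q\<close> interchanged, and the products summing to 1 are the same.\<close>

lemma separability_system_opposite_ring:
  assumes sep: "separability_system R S M I p q"
  shows "separability_system R (opposite_ring S) M I q p"
proof -
  have casimir: "(\<Oplus>\<^bsub>M\<^esub>i\<in>I. \<beta> (q i \<otimes>\<^bsub>S\<^esub> s) (p i)) = (\<Oplus>\<^bsub>M\<^esub>i\<in>I. \<beta> (q i) (s \<otimes>\<^bsub>S\<^esub> p i))"
    if "balanced_map R (opposite_ring S) M \<beta>" "s \<in> carrier S" for \<beta> s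
  proof -
    have "balanced_map R S M (\<lambda>u v. \<beta> v u)"
      using that(1) by (simp add: balanced_map_def)
    from separability_system_casimir[OF sep this that(2)] show ?thesis by simp
  qed
  show ?thesis
    unfolding separability_system_def opposite_ring_simps
  proof (intro conjI allI impI ballI)
    show "finite I" "q \<in> I \<rightarrow> carrier S" "p \<in> I \<rightarrow> carrier S"
      "(\<Oplus>\<^bsub>S\<^esub>i\<in>I. p i \<otimes>\<^bsub>S\<^esub> q i) = \<one>\<^bsub>S\<^esub>"
      using sep by (simp_all only: separability_system_def)
  qed (rule casimir)
qed

text \<open>Submodules see the scalars only through their carrier, so complements over a ring and
  over its opposite are the same notion.\<close>

lemma submodule_carrier_cong:
  assumes "carrier R = carrier R'"
  shows "submodule N R M \<longleftrightarrow> submodule N R' M"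
  using assms by (simp add: submodule_def submodule_axioms_def)

lemma has_complement_carrier_cong:
  assumes "carrier R = carrier R'"
  shows "has_complement R M N \<longleftrightarrow> has_complement R' M N"
  unfolding has_complement_def submodule_carrier_cong[OF assms] ..

text \<open>The data \<open>I\<close>, \<open>p\<close>, \<open>q\<close> are fixed before
  \<open>M\<close>: one system must work for the additive group of every module.\<close>

lemma left_semisimple_extensionI:
  fixes S :: "('s, 'k) ring_scheme"
  assumes "unital_ring_extension R S"
    and "\<And>M :: ('s, 'm) module. abelian_group M \<Longrightarrow> separability_system R S M I p q"
  shows "left_semisimple_extension TYPE('m) R S"
  unfolding left_semisimple_extension_def
proof (intro conjI allI impI)
  fix M :: "('s, 'm) module" and N
  assume M: "left_module S M" and "submodule N S M" "has_complement (S\<lparr>carrier := R\<rparr>) M N"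
  interpret left_module S M by fact
  have "R \<subseteq> carrier S"
    using assms(1) subringE(1) by (auto simp: unital_ring_extension_def)
  then show "has_complement S M N"
    using has_complement_if_separable assms(2) M.abelian_group_axioms
      \<open>submodule N S M\<close> \<open>has_complement (S\<lparr>carrier := R\<rparr>) M N\<close> by blast
qed fact

lemma right_semisimple_extensionI:
  fixes S :: "('s, 'k) ring_scheme"
  assumes "unital_ring_extension R S"
    and "\<And>M :: ('s, 'm) module. abelian_group M \<Longrightarrow> separability_system R S M I p q"
  shows "right_semisimple_extension TYPE('m) R S"
  unfolding right_semisimple_extension_def
proof (intro conjI allI impI)
  fix M :: "('s, 'm) module" and N
  assume M: "right_module S M" and N: "submodule N S M" "has_complement (S\<lparr>carrier := R\<rparr>) M N"
  let ?S = "opposite_ring S"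
  interpret op: left_module ?S M by (rule left_module_opposite_ring) fact
  have R: "ring S" "R \<subseteq> carrier S"
    using assms(1) subringE(1) by (auto simp: unital_ring_extension_def)
  have "separability_system R ?S M I q p"
    using separability_system_opposite_ring assms(2) op.M.abelian_group_axioms by blast
  moreover have "submodule N ?S M" "has_complement (?S\<lparr>carrier := R\<rparr>) M N"
    using N submodule_carrier_cong[of S ?S]
      has_complement_carrier_cong[of "S\<lparr>carrier := R\<rparr>" "?S\<lparr>carrier := R\<rparr>"] by auto
  ultimately have "has_complement ?S M N"
    using op.has_complement_if_separable R by simp
  then show "has_complement S M N"
    using has_complement_carrier_cong[of S ?S M N] by simp
qed fact

section \<open>Partial actions\<close>

context groupoid
begin

text \<open>\<open>ginv\<close> is a definite description, so it means nothing before inverses are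
  known to be unique; for two inverses h and k of g, both equal h g k.\<close>

lemma ginv_props:
  assumes "g \<in> carrier G"
  shows "ginv G g \<in> carrier G" "src (ginv G g) = tgt g" "tgt (ginv G g) = src g"
    "ginv G g \<cdot> g = src g" "g \<cdot> ginv G g = tgt g"
proof -
  let ?P = "\<lambda>h. h \<in> carrier G \<and> src h = tgt g \<and> tgt h = src g \<and> h \<cdot> g = src g \<and> g \<cdot> h = tgt g"
  have "\<exists>!h. ?P h"
  proof (rule ex_ex1I)
    show "\<exists>h. ?P h" using invertible[OF assms] by blast
    fix h k assume h: "?P h" and k: "?P k"
    have "h = h \<cdot> (g \<cdot> k)" using h k comp_src by metis
    also have "\<dots> = (h \<cdot> g) \<cdot> k" using h k assms comp_assoc by metis
    also have "\<dots> = k" using h k tgt_comp_id by metis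
    finally show "h = k" .
  qed
  from theI'[OF this] show "ginv G g \<in> carrier G" "src (ginv G g) = tgt g" "tgt (ginv G g) = src g"
    "ginv G g \<cdot> g = src g" "g \<cdot> ginv G g = tgt g"
    unfolding ginv_def by auto
qed

lemma ginv_comp_cancel:
  assumes "g \<in> carrier G" "h \<in> carrier G"
  shows "src g = tgt h \<Longrightarrow> ginv G g \<cdot> (g \<cdot> h) = h"
    and "tgt g = tgt h \<Longrightarrow> g \<cdot> (ginv G g \<cdot> h) = h"
proof -
  show "ginv G g \<cdot> (g \<cdot> h) = h" if "src g = tgt h"
    using that assms comp_assoc[of "ginv G g" g h] by (simp add: ginv_props tgt_comp_id)
  show "g \<cdot> (ginv G g \<cdot> h) = h" if "tgt g = tgt h"
    using that assms comp_assoc[of g "ginv G g" h] by (simp add: ginv_props tgt_comp_id)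
qed

lemma ginv_unique:
  assumes "g \<in> carrier G" "h \<in> carrier G" "src h = tgt g" "h \<cdot> g = src g"
  shows "h = ginv G g"
proof -
  have "h = h \<cdot> (g \<cdot> ginv G g)" using assms comp_src by (metis ginv_props(5))
  also have "\<dots> = (h \<cdot> g) \<cdot> ginv G g" using assms comp_assoc by (metis ginv_props(1,3))
  also have "\<dots> = ginv G g" using assms tgt_comp_id by (metis ginv_props(1,3))
  finally show ?thesis .
qed

lemma ginv_ginv: "g \<in> carrier G \<Longrightarrow> ginv G (ginv G g) = g"
  using ginv_unique[of "ginv G g" g] by (simp add: ginv_props)

lemma ginv_comp:
  assumes "g \<in> carrier G" "h \<in> carrier G" "src g = tgt h"
  shows "ginv G (g \<cdot> h) = ginv G h \<cdot> ginv G g"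
proof (rule sym, rule ginv_unique)
  show "(ginv G h \<cdot> ginv G g) \<cdot> (g \<cdot> h) = src (g \<cdot> h)"
    using assms comp_assoc[of "ginv G h" "ginv G g" "g \<cdot> h"]
    by (simp add: ginv_props ginv_comp_cancel comp_closed src_comp tgt_comp)
qed (use assms in \<open>simp_all add: ginv_props comp_closed src_comp tgt_comp\<close>)

lemma objectsD: "y \<in> objects G \<Longrightarrow> y \<in> carrier G" "y \<in> objects G \<Longrightarrow> src y = y"
  "y \<in> objects G \<Longrightarrow> tgt y = y"
  using tgt_src by (auto simp: objects_def) metis

lemma src_object: "g \<in> carrier G \<Longrightarrow> src g \<in> objects G"
  by (simp add: objects_def src_closed src_src)

lemma tgt_object: "g \<in> carrier G \<Longrightarrow> tgt g \<in> objects G"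
  by (simp add: objects_def tgt_closed src_tgt)

lemma object_comp:
  assumes "h \<in> carrier G" "src g = tgt h" "g \<in> objects G"
  shows "g \<cdot> h = h"
  using assms tgt_comp_id objectsD(2) by metis

lemma ginv_object: "y \<in> objects G \<Longrightarrow> ginv G y = y"
  using ginv_unique[of y y] comp_src[of y] by (simp add: objectsD)

end

section \<open>Central idempotents and the total operators of a partial action\<close>

context unital_partial_action
begin

lemma e_comm: "g \<in> carrier G \<Longrightarrow> e g * a = a * e g"
  using e_central by (auto simp: center_of_def)

text \<open>Membership in an ideal generated by a central idempotent becomes an equation, so that
  most later arguments about domains are calculations with idempotents.\<close>

lemma D_iff: "g \<in> carrier G \<Longrightarrow> a \<in> D g \<longleftrightarrow> a * e g = a"
  using D_eq e_idem by (auto simp: mult.assoc) metis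

lemma D_mult: "g \<in> carrier G \<Longrightarrow> a \<in> D g \<Longrightarrow> a * b \<in> D g" "g \<in> carrier G \<Longrightarrow> a \<in> D g \<Longrightarrow> b * a \<in> D g"
  by (simp_all add: D_iff mult.assoc flip: e_comm) (metis e_comm mult.assoc)+

lemma D_e: "g \<in> carrier G \<Longrightarrow> e g \<in> D g" "g \<in> carrier G \<Longrightarrow> a * e g \<in> D g"
  "g \<in> carrier G \<Longrightarrow> e g * a \<in> D g"
  by (simp_all add: D_iff e_idem mult.assoc) (metis e_comm e_idem mult.assoc)

lemma D_zero: "g \<in> carrier G \<Longrightarrow> 0 \<in> D g"
  and D_add: "g \<in> carrier G \<Longrightarrow> a \<in> D g \<Longrightarrow> b \<in> D g \<Longrightarrow> a + b \<in> D g"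
  and D_minus: "g \<in> carrier G \<Longrightarrow> a \<in> D g \<Longrightarrow> - a \<in> D g"
  by (simp_all add: D_iff distrib_right)

lemma D_tgt: "g \<in> carrier G \<Longrightarrow> a \<in> D g \<Longrightarrow> a \<in> D (tgt g)"
  using ideal_tgt[of g] by (auto simp: ideal_in_def)

lemma e_tgt: "g \<in> carrier G \<Longrightarrow> e g * e (tgt g) = e g" "g \<in> carrier G \<Longrightarrow> e (tgt g) * e g = e g"
  using D_tgt[OF _ D_e(1)] D_iff tgt_closed e_comm by metis+

text \<open>Each idempotent is the identity of the common ideal. This turns the group-type
  condition, which compares ideals, into equations between idempotents.\<close>

lemma e_eqI: "g \<in> carrier G \<Longrightarrow> h \<in> carrier G \<Longrightarrow> D g = D h \<Longrightarrow> e g = e h"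
  using D_e D_iff e_comm by metis

lemma \<alpha>_closed: "g \<in> carrier G \<Longrightarrow> a \<in> D (ginv G g) \<Longrightarrow> \<alpha> g a \<in> D g"
  using iso[of g] by (auto simp: ring_iso_on_def bij_betw_def)

lemma \<alpha>_surj: "g \<in> carrier G \<Longrightarrow> b \<in> D g \<Longrightarrow> \<exists>a \<in> D (ginv G g). \<alpha> g a = b"
  using iso[of g] unfolding ring_iso_on_def bij_betw_def by (metis imageE)

lemma \<alpha>_add: "g \<in> carrier G \<Longrightarrow> a \<in> D (ginv G g) \<Longrightarrow> b \<in> D (ginv G g) \<Longrightarrow> \<alpha> g (a + b) = \<alpha> g a + \<alpha> g b"
  and \<alpha>_mult: "g \<in> carrier G \<Longrightarrow> a \<in> D (ginv G g) \<Longrightarrow> b \<in> D (ginv G g) \<Longrightarrow> \<alpha> g (a * b) = \<alpha> g a * \<alpha> g b"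
  using iso by (auto simp: ring_iso_on_def)

text \<open>The composite of \<open>g\<close> with its inverse is the object \<open>tgt g\<close>,
  which acts as the identity on its ideal.\<close>

lemma \<alpha>_ginv:
  assumes g: "g \<in> carrier G" and a: "a \<in> D g"
  shows "\<alpha> g (\<alpha> (ginv G g) a) = a"
proof -
  have i: "ginv G g \<in> carrier G" using g by (rule ginv_props)
  have "\<alpha> (ginv G g) a \<in> D (ginv G g)" using \<alpha>_closed[OF i] a g by (simp add: ginv_ginv)
  then have "\<alpha> (g \<cdot> ginv G g) a = \<alpha> g (\<alpha> (ginv G g) a)"
    using act_comp[of g "ginv G g" a] g a i by (simp add: ginv_ginv ginv_props)
  then show ?thesis
    using act_object[OF tgt_object[OF g] D_tgt[OF g a]] g by (simp add: ginv_props)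
qed

text \<open>The total version of \<open>\<alpha> g\<close>: the argument is first cut down to the
  domain. It is additive and multiplicative on the whole ring, and \<open>a * act g b\<close> is the
  coefficient in the product of a\<delta>_g and b\<delta>_h.\<close>

definition act :: "'g \<Rightarrow> 'a \<Rightarrow> 'a" where
  "act g a = \<alpha> g (a * e (ginv G g))"

lemma act_eq_\<alpha>: "g \<in> carrier G \<Longrightarrow> a \<in> D (ginv G g) \<Longrightarrow> act g a = \<alpha> g a"
  by (simp add: act_def D_iff ginv_props(1))

lemma act_closed: "g \<in> carrier G \<Longrightarrow> act g a \<in> D g"
  by (simp add: act_def \<alpha>_closed D_e ginv_props(1))

lemma act_e: "g \<in> carrier G \<Longrightarrow> act g a * e g = act g a" "g \<in> carrier G \<Longrightarrow> e g * act g a = act g a"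
  using act_closed D_iff e_comm by metis+

lemma act_add: "g \<in> carrier G \<Longrightarrow> act g (a + b) = act g a + act g b"
  by (simp add: act_def distrib_right \<alpha>_add D_e ginv_props(1))

lemma act_zero: "g \<in> carrier G \<Longrightarrow> act g 0 = 0"
  using act_add[of g 0 0] by simp

lemma act_sum: "g \<in> carrier G \<Longrightarrow> act g (sum f I) = (\<Sum>i\<in>I. act g (f i))"
  by (induction I rule: infinite_finite_induct) (auto simp: act_add act_zero)

lemma act_mult:
  assumes "g \<in> carrier G"
  shows "act g (a * b) = act g a * act g b"
proof -
  have i: "ginv G g \<in> carrier G" using assms by (rule ginv_props)
  have "a * b * e (ginv G g) = (a * e (ginv G g)) * (b * e (ginv G g))"
    by (metis i e_comm e_idem mult.assoc)
  then show ?thesis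
    using assms i by (simp add: act_def \<alpha>_mult D_e)
qed

text \<open>A surjective multiplicative map carries an identity to an identity: \<open>e g\<close>
  is the image of some \<open>a\<close> in the domain, and \<open>a\<close> absorbs the idempotent
  there.\<close>

lemma act_e_ginv: "g \<in> carrier G \<Longrightarrow> act g (e (ginv G g)) = e g"
proof -
  assume g: "g \<in> carrier G"
  have i: "ginv G g \<in> carrier G" using g by (rule ginv_props)
  obtain a where a: "a \<in> D (ginv G g)" "\<alpha> g a = e g" using \<alpha>_surj[OF g D_e(1)[OF g]] by blast
  then have "act g a = e g" using act_eq_\<alpha> g by simp
  moreover have "act g a = act g a * act g (e (ginv G g))"
    using a(1) act_mult[OF g, of a "e (ginv G g)"] i by (simp add: D_iff)
  ultimately show ?thesis using act_e(2)[OF g] by simp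
qed

lemma act_mult_e_ginv: "g \<in> carrier G \<Longrightarrow> act g (a * e (ginv G g)) = act g a"
  by (simp add: act_mult act_e_ginv act_e)

lemma act_object_eq: "y \<in> objects G \<Longrightarrow> act y a = a * e y"
  by (simp add: act_def act_object ginv_object D_e objectsD)

lemma act_e_src: "g \<in> carrier G \<Longrightarrow> act g (e (src g)) = e g"
  using act_mult_e_ginv[of g "e (src g)"] e_tgt(2)[of "ginv G g"]
  by (simp add: ginv_props act_e_ginv)

text \<open>As \<open>b\<close> lies in the range of \<open>\<alpha> h\<close>, the element
  \<open>\<alpha> g b\<close> is also a value of \<open>\<alpha> (g \<cdot> h)\<close>.\<close>

lemma \<alpha>_inter:
  assumes "g \<in> carrier G" "h \<in> carrier G" "src g = tgt h" "b \<in> D (ginv G g)" "b \<in> D h"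
  shows "\<alpha> g b \<in> D (g \<cdot> h)"
proof -
  obtain a where "a \<in> D (ginv G h)" "\<alpha> h a = b" using \<alpha>_surj assms by blast
  then have "a \<in> D (ginv G (g \<cdot> h))" "\<alpha> (g \<cdot> h) a = \<alpha> g b"
    using act_comp[of g h a] assms by auto
  then show ?thesis using \<alpha>_closed assms comp_closed by metis
qed

text \<open>The idempotent form of the rule that \<alpha> at g maps the intersection of its domain
  with A_h onto the intersection of A_g with A_gh. Each inclusion is one use of
  \<open>\<alpha>_inter\<close>.\<close>

lemma act_e_comp:
  assumes "g \<in> carrier G" "h \<in> carrier G" "src g = tgt h"
  shows "act g (e h) = e g * e (g \<cdot> h)"
proof -
  let ?i = "ginv G g" and ?k = "g \<cdot> h"
  have i: "?i \<in> carrier G" and k: "?k \<in> carrier G" using assms by (auto intro: ginv_props comp_closed)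
  have "e h * e ?i \<in> D ?i" "e h * e ?i \<in> D h" using assms i D_e D_mult by auto
  then have 1: "act g (e h) \<in> D ?k" unfolding act_def using assms \<alpha>_inter by blast
  \<comment> \<open>The reverse inclusion: pulling \<open>e g * e ?k\<close> back along
    \<open>g\<close> lands in \<open>D h\<close>, because \<open>?i \<cdot> ?k\<close> is
    \<open>h\<close>. Hence \<open>?b\<close> absorbs \<open>e h\<close>, and so its image absorbs
    \<open>act g (e h)\<close>.\<close>
  let ?b = "\<alpha> ?i (e g * e ?k)"
  have "e g * e ?k \<in> D g" "e g * e ?k \<in> D ?k" using assms k D_e D_mult by auto
  then have b: "?b \<in> D ?i" "?b \<in> D (?i \<cdot> ?k)" "\<alpha> g ?b = e g * e ?k"
    using \<alpha>_closed[OF i] \<alpha>_inter[OF i k] \<alpha>_ginv assms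
    by (simp_all add: ginv_ginv ginv_props tgt_comp)
  then have "?b \<in> D h" using ginv_comp_cancel(1) assms by simp
  then have "act g ?b = act g ?b * act g (e h)"
    using act_mult[of g ?b "e h"] assms D_iff by simp
  then have "e g * e ?k = e g * e ?k * act g (e h)"
    using b act_eq_\<alpha> assms by simp
  also have "\<dots> = act g (e h)"
    using 1 act_e(2) assms k D_iff e_comm mult.assoc by metis
  finally show ?thesis by simp
qed

text \<open>The factor \<open>e g\<close> is the exact defect of functoriality: the left side always
  lies in \<open>D g\<close>, while \<open>act (g \<cdot> h) a\<close> need not.\<close>

lemma act_act:
  assumes "g \<in> carrier G" "h \<in> carrier G" "src g = tgt h"
  shows "act g (act h a) = e g * act (g \<cdot> h) a"
proof -
  let ?i = "ginv G g" and ?j = "ginv G h" and ?k = "g \<cdot> h"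
  have i: "?i \<in> carrier G" and j: "?j \<in> carrier G" and k: "?k \<in> carrier G"
    using assms by (auto intro: ginv_props comp_closed)
  have "e h * e ?i \<in> D h" using assms D_mult D_e by blast
  \<comment> \<open>Multiplying by \<open>f\<close> cuts \<open>a\<close> down to the part that
    \<open>\<alpha> h\<close> sends into the domain of \<open>\<alpha> g\<close>, where the partial
    composition axiom applies. The image of \<open>f\<close> supplies the idempotents of the final
    formula.\<close>
  then obtain f where f: "f \<in> D ?j" "\<alpha> h f = e h * e ?i" using \<alpha>_surj assms by blast
  have af: "a * f \<in> D ?j" using f j D_mult by blast
  have *: "\<alpha> h (a * f) = act h a * e ?i"
  proof -
    have "\<alpha> h (a * f) = act h a * act h f"
      using act_eq_\<alpha> assms af act_mult by metis
    also have "act h f = e h * e ?i" using act_eq_\<alpha> f assms by simp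
    also have "act h a * (e h * e ?i) = act h a * e ?i"
      using act_e assms by (simp flip: mult.assoc)
    finally show ?thesis .
  qed
  have "\<alpha> h f \<in> D ?i \<inter> D h" "\<alpha> h (a * f) \<in> D ?i \<inter> D h"
    unfolding f(2) * using assms i D_e D_mult act_closed by auto
  then have c: "f \<in> D (ginv G ?k)" "\<alpha> ?k f = \<alpha> g (\<alpha> h f)"
    "a * f \<in> D (ginv G ?k)" "\<alpha> ?k (a * f) = \<alpha> g (\<alpha> h (a * f))"
    using act_comp assms f(1) af by blast+
  have "act g (act h a) = act ?k (a * f)"
    using c(3,4) * act_eq_\<alpha>[OF k] by (simp add: act_def)
  also have "\<dots> = act ?k a * act ?k f" using act_mult k by simp
  also have "act ?k f = act g (e h)"
    using c(1,2) f act_eq_\<alpha>[OF k] by (simp add: act_def)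
  also have "act ?k a * act g (e h) = e g * act ?k a"
    using act_e_comp assms act_e(1)[OF k] e_comm by (metis mult.assoc)
  finally show ?thesis .
qed

text \<open>\<open>act g c\<close> commutes with arbitrary ring elements, not just with those of
  \<open>D g\<close>: it absorbs \<open>e g\<close>, and \<open>e g * a\<close> is the image under
  \<open>act g\<close> of an element that commutes with \<open>c\<close>.\<close>

lemma act_central:
  assumes g: "g \<in> carrier G" and c: "c \<in> center_of UNIV"
  shows "act g c * a = a * act g c"
proof -
  have i: "ginv G g \<in> carrier G" using g by (rule ginv_props)
  define b where "b = act (ginv G g) a"
  have b: "act g b = e g * a"
    using act_act[OF g i] act_object_eq[OF tgt_object[OF g]] g e_tgt tgt_closed
    by (simp add: b_def ginv_props) (metis e_comm mult.assoc)
  have "act g c * a = act g c * act g b"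
    using b act_e g by (simp flip: mult.assoc)
  also have "\<dots> = act g b * act g c"
    using c by (simp add: center_of_def flip: act_mult[OF g])
  also have "\<dots> = a * act g c"
    using b act_e(2)[OF g] e_comm[OF g] by (metis mult.assoc)
  finally show ?thesis .
qed

end

section \<open>The partial skew groupoid ring\<close>

locale finite_unital_partial_action = unital_partial_action G D \<alpha> e
  for G :: "('g, 'k) groupoid_scheme" (structure)
    and D :: "'g \<Rightarrow> 'a::ring set" and \<alpha> :: "'g \<Rightarrow> 'a \<Rightarrow> 'a" and e :: "'g \<Rightarrow> 'a" +
  assumes finite_carrier: "finite (carrier G)"
begin

abbreviation S :: "('g \<Rightarrow> 'a) ring" where
  "S \<equiv> skew_groupoid_ring G D \<alpha> e"

text \<open>The monomial a\<delta>_g.\<close>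

definition sing :: "'g \<Rightarrow> 'a \<Rightarrow> 'g \<Rightarrow> 'a" where
  "sing g a = (\<lambda>k. if k = g then a else 0)"

definition factorizations :: "'g \<Rightarrow> ('g \<times> 'g) set" where
  "factorizations k = {(g, h). g \<in> carrier G \<and> h \<in> carrier G \<and> src g = tgt h \<and> g \<cdot> h = k}"

lemma finite_factorizations: "finite (factorizations k)"
  by (rule finite_subset[of _ "carrier G \<times> carrier G"])
    (auto simp: factorizations_def finite_carrier)

lemma skew_simps:
  "\<zero>\<^bsub>S\<^esub> = (\<lambda>g. 0)"
  "u \<oplus>\<^bsub>S\<^esub> v = (\<lambda>g. u g + v g)"
  "\<one>\<^bsub>S\<^esub> = (\<lambda>g. if g \<in> objects G then e g else 0)"
  by (simp_all add: skew_groupoid_ring_def)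

lemma skew_carrier:
  "u \<in> carrier S \<longleftrightarrow> (\<forall>g \<in> carrier G. u g \<in> D g) \<and> (\<forall>g. g \<notin> carrier G \<longrightarrow> u g = 0)"
proof -
  have "finite {g. u g \<noteq> 0}" if "\<forall>g. g \<notin> carrier G \<longrightarrow> u g = 0"
    by (rule finite_subset[OF _ finite_carrier]) (use that in auto)
  then show ?thesis by (auto simp: skew_groupoid_ring_def)
qed

text \<open>Terms with a zero coefficient vanish, so the sum may run over all factorizations of
  \<open>k\<close>. An index set independent of the supports makes distributivity a termwise
  matter.\<close>

lemma skew_mult:
  "u \<otimes>\<^bsub>S\<^esub> v = (\<lambda>k. \<Sum>(g, h) \<in> factorizations k. u g * act g (v h))"
proof
  fix k
  show "(u \<otimes>\<^bsub>S\<^esub> v) k = (\<Sum>(g, h) \<in> factorizations k. u g * act g (v h))"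
    unfolding skew_groupoid_ring_def act_def[symmetric] monoid.simps
    by (rule sum.mono_neutral_left)
      (auto simp: finite_factorizations, auto simp: factorizations_def act_zero)
qed

lemma sing_closed: "g \<in> carrier G \<Longrightarrow> a \<in> D g \<Longrightarrow> sing g a \<in> carrier S"
  by (auto simp: skew_carrier sing_def D_zero)

text \<open>Used for products of two monomials and for products of a monomial with 1 or with an
  embedded element of A: in each case only one composable pair of arrows can carry nonzero
  coefficients.\<close>

lemma skew_mult_single_term:
  assumes "g \<in> carrier G" "h \<in> carrier G" "src g = tgt h"
    and single: "\<And>g' h'. \<lbrakk>g' \<in> carrier G; h' \<in> carrier G; src g' = tgt h'; u g' \<noteq> 0; v h' \<noteq> 0\<rbrakk>
      \<Longrightarrow> g' = g \<and> h' = h"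
  shows "u \<otimes>\<^bsub>S\<^esub> v = sing (g \<cdot> h) (u g * act g (v h))"
proof
  fix k
  have "(u \<otimes>\<^bsub>S\<^esub> v) k = (\<Sum>p \<in> factorizations k. if (g, h) = p then u g * act g (v h) else 0)"
    unfolding skew_mult
  proof (rule sum.cong)
    fix p assume p: "p \<in> factorizations k"
    obtain g' h' where p': "p = (g', h')" by (cases p)
    have "u g' = 0 \<or> v h' = 0" if "(g, h) \<noteq> p"
      using single[of g' h'] p that by (auto simp: p' factorizations_def)
    then show "(case p of (g, h) \<Rightarrow> u g * act g (v h)) = (if (g, h) = p then u g * act g (v h) else 0)"
      using p by (auto simp: p' factorizations_def act_zero)
  qed simp
  also have "\<dots> = (if (g, h) \<in> factorizations k then u g * act g (v h) else 0)"
    by (rule sum.delta'[OF finite_factorizations])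
  also have "\<dots> = sing (g \<cdot> h) (u g * act g (v h)) k"
    using assms(1-3) by (auto simp: factorizations_def sing_def)
  finally show "(u \<otimes>\<^bsub>S\<^esub> v) k = sing (g \<cdot> h) (u g * act g (v h)) k" .
qed

lemma skew_mult_no_term:
  assumes "\<And>g h. \<lbrakk>g \<in> carrier G; h \<in> carrier G; src g = tgt h; u g \<noteq> 0; v h \<noteq> 0\<rbrakk> \<Longrightarrow> False"
  shows "u \<otimes>\<^bsub>S\<^esub> v = \<zero>\<^bsub>S\<^esub>"
proof -
  have "u g * act g (v h) = 0" if "g \<in> carrier G" "h \<in> carrier G" "src g = tgt h" for g h
  proof -
    have "u g = 0 \<or> v h = 0" using assms[of g h] that by blast
    then show ?thesis using that by (auto simp: act_zero)
  qed
  then show ?thesis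
    unfolding skew_mult skew_simps by (intro ext sum.neutral) (auto simp: factorizations_def)
qed

lemma sing_same [simp]: "sing g a g = a"
  by (simp add: sing_def)

lemma sing_nonzeroD: "sing g a k \<noteq> 0 \<Longrightarrow> k = g"
  by (simp add: sing_def split: if_splits)

lemma sing_mult:
  assumes "g \<in> carrier G" "h \<in> carrier G"
  shows "sing g a \<otimes>\<^bsub>S\<^esub> sing h b = (if src g = tgt h then sing (g \<cdot> h) (a * act g b) else \<zero>\<^bsub>S\<^esub>)"
proof (cases "src g = tgt h")
  case True
  have "sing g a \<otimes>\<^bsub>S\<^esub> sing h b = sing (g \<cdot> h) (sing g a g * act g (sing h b h))"
    by (rule skew_mult_single_term) (use assms True in \<open>blast dest: sing_nonzeroD\<close>)+
  also have "\<dots> = sing (g \<cdot> h) (a * act g b)" by (simp only: sing_same)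
  finally show ?thesis unfolding if_P[OF True] .
next
  case False
  have "sing g a \<otimes>\<^bsub>S\<^esub> sing h b = \<zero>\<^bsub>S\<^esub>"
    by (rule skew_mult_no_term) (use False in \<open>blast dest: sing_nonzeroD\<close>)
  then show ?thesis unfolding if_not_P[OF False] .
qed

lemma skew_zero_closed: "\<zero>\<^bsub>S\<^esub> \<in> carrier S"
  by (auto simp: skew_carrier skew_simps D_zero)

lemma skew_add_closed: "u \<in> carrier S \<Longrightarrow> v \<in> carrier S \<Longrightarrow> u \<oplus>\<^bsub>S\<^esub> v \<in> carrier S"
  by (auto simp: skew_carrier skew_simps D_add)

text \<open>Since \<open>G\<close> is finite, every element is a finite sum of monomials; the
  induction runs over a finite set outside of which \<open>u\<close> vanishes.\<close>

lemma skew_induct [consumes 1, case_names zero sing add]: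
  assumes "u \<in> carrier S"
    and zero: "P \<zero>\<^bsub>S\<^esub>"
    and sing: "\<And>g a. g \<in> carrier G \<Longrightarrow> a \<in> D g \<Longrightarrow> P (sing g a)"
    and add: "\<And>u v. u \<in> carrier S \<Longrightarrow> v \<in> carrier S \<Longrightarrow> P u \<Longrightarrow> P v \<Longrightarrow> P (u \<oplus>\<^bsub>S\<^esub> v)"
  shows "P u"
proof -
  have "P u" if "F \<subseteq> carrier G" "u \<in> carrier S" "\<And>g. g \<notin> F \<Longrightarrow> u g = 0" for F u
    using finite_subset[OF that(1) finite_carrier] that
  proof (induction F arbitrary: u rule: finite_induct)
    case empty
    then have "u = \<zero>\<^bsub>S\<^esub>" by (auto simp: skew_simps)
    then show ?case using zero by simp
  next
    case (insert g F)
    let ?v = "u(g := 0)"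
    have g: "g \<in> carrier G" "u g \<in> D g" using insert.prems by (auto simp: skew_carrier)
    have v: "?v \<in> carrier S" using insert.prems by (auto simp: skew_carrier D_zero)
    have "F \<subseteq> carrier G" "\<And>k. k \<notin> F \<Longrightarrow> ?v k = 0" using insert.prems by auto
    with v have "P ?v" by (intro insert.IH)
    then have "P (?v \<oplus>\<^bsub>S\<^esub> sing g (u g))"
      by (rule add[OF v sing_closed[OF g] _ sing[OF g]])
    moreover have "?v \<oplus>\<^bsub>S\<^esub> sing g (u g) = u" by (auto simp: skew_simps sing_def)
    ultimately show ?case by (simp only:)
  qed
  from this[of "carrier G" u] show ?thesis using assms(1) by (simp add: skew_carrier)
qed

lemma skew_l_distr: "(u \<oplus>\<^bsub>S\<^esub> v) \<otimes>\<^bsub>S\<^esub> w = u \<otimes>\<^bsub>S\<^esub> w \<oplus>\<^bsub>S\<^esub> v \<otimes>\<^bsub>S\<^esub> w"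
  unfolding skew_mult skew_simps by (simp add: distrib_right case_prod_unfold sum.distrib)

lemma skew_r_distr: "w \<otimes>\<^bsub>S\<^esub> (u \<oplus>\<^bsub>S\<^esub> v) = w \<otimes>\<^bsub>S\<^esub> u \<oplus>\<^bsub>S\<^esub> w \<otimes>\<^bsub>S\<^esub> v"
  unfolding skew_mult skew_simps
  by (rule ext, subst sum.distrib[symmetric], rule sum.cong)
    (auto simp: factorizations_def act_add distrib_left)

lemma skew_mult_zero: "\<zero>\<^bsub>S\<^esub> \<otimes>\<^bsub>S\<^esub> u = \<zero>\<^bsub>S\<^esub>" "u \<otimes>\<^bsub>S\<^esub> \<zero>\<^bsub>S\<^esub> = \<zero>\<^bsub>S\<^esub>"
  by (rule skew_mult_no_term, simp add: skew_simps)+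

text \<open>Since \<open>b\<close> absorbs \<open>e h\<close>, its image absorbs
  \<open>act g (e h)\<close>, and \<open>act_e_comp\<close> turns this into absorbing
  \<open>e (g \<cdot> h)\<close>.\<close>

lemma mult_act_closed:
  assumes "g \<in> carrier G" "h \<in> carrier G" "src g = tgt h" "a \<in> D g" "b \<in> D h"
  shows "a * act g b \<in> D (g \<cdot> h)"
proof -
  have "act g b = act g b * act g (e h)"
    using assms by (simp add: D_iff flip: act_mult)
  also have "\<dots> = act g b * e (g \<cdot> h)"
    using assms by (simp add: act_e_comp act_e flip: mult.assoc)
  finally have "act g b * e (g \<cdot> h) = act g b" by simp
  then show ?thesis using assms by (simp add: D_iff comp_closed mult.assoc)
qed

lemma skew_mult_closed:
  assumes "u \<in> carrier S" "v \<in> carrier S"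
  shows "u \<otimes>\<^bsub>S\<^esub> v \<in> carrier S"
  using assms(1)
proof (induction u rule: skew_induct)
  case (sing g a)
  show ?case using assms(2)
  proof (induction v rule: skew_induct)
    case (sing h b)
    then show ?case
      using \<open>g \<in> carrier G\<close> \<open>a \<in> D g\<close>
      by (auto simp: sing_mult skew_zero_closed intro!: sing_closed comp_closed mult_act_closed)
  qed (auto simp: skew_mult_zero skew_zero_closed skew_r_distr skew_add_closed)
qed (auto simp: skew_mult_zero skew_zero_closed skew_l_distr skew_add_closed)

text \<open>The two bracketings differ by the factor \<open>e g\<close> from \<open>act_act\<close>,
  and the middle coefficient \<open>act g b\<close> absorbs it.\<close>

lemma sing_mult_assoc:
  assumes "g \<in> carrier G" "h \<in> carrier G" "l \<in> carrier G" "a \<in> D g" "b \<in> D h"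
  shows "(sing g a \<otimes>\<^bsub>S\<^esub> sing h b) \<otimes>\<^bsub>S\<^esub> sing l c = sing g a \<otimes>\<^bsub>S\<^esub> (sing h b \<otimes>\<^bsub>S\<^esub> sing l c)"
proof (cases "src g = tgt h \<and> src h = tgt l")
  case True
  have "act g (b * act h c) = act g b * (e g * act (g \<cdot> h) c)"
    using assms True by (simp add: act_mult act_act)
  also have "\<dots> = act g b * act (g \<cdot> h) c"
    using assms by (simp add: act_e flip: mult.assoc)
  finally have "act g (b * act h c) = act g b * act (g \<cdot> h) c" .
  then show ?thesis
    using assms True by (simp add: sing_mult comp_closed src_comp tgt_comp comp_assoc mult.assoc)
next
  case False
  then show ?thesis
    using assms by (auto simp: sing_mult skew_mult_zero comp_closed src_comp tgt_comp)
qed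

lemma skew_assoc:
  assumes "u \<in> carrier S" "v \<in> carrier S" "w \<in> carrier S"
  shows "(u \<otimes>\<^bsub>S\<^esub> v) \<otimes>\<^bsub>S\<^esub> w = u \<otimes>\<^bsub>S\<^esub> (v \<otimes>\<^bsub>S\<^esub> w)"
  using assms(1)
proof (induction u rule: skew_induct)
  case u: (sing g a)
  show ?case using assms(2)
  proof (induction v rule: skew_induct)
    case v: (sing h b)
    show ?case using assms(3)
    proof (induction w rule: skew_induct)
      case (sing l c)
      then show ?case using u v sing_mult_assoc by blast
    qed (simp_all add: skew_mult_zero skew_r_distr)
  qed (simp_all add: skew_mult_zero skew_r_distr skew_l_distr)
qed (simp_all add: skew_mult_zero skew_l_distr)

lemma skew_one_closed: "\<one>\<^bsub>S\<^esub> \<in> carrier S"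
  by (auto simp: skew_carrier skew_simps D_zero D_e dest: objectsD)

lemma embedding_nonzeroD: "skew_embedding G e a g \<noteq> 0 \<Longrightarrow> g \<in> objects G"
  and one_nonzeroD: "\<one>\<^bsub>S\<^esub> g \<noteq> 0 \<Longrightarrow> g \<in> objects G"
  by (simp_all add: skew_embedding_def skew_simps split: if_splits)

lemma embedding_mult_sing:
  assumes "g \<in> carrier G" "b \<in> D g"
  shows "skew_embedding G e a \<otimes>\<^bsub>S\<^esub> sing g b = sing g (a * b)"
proof -
  have "skew_embedding G e a \<otimes>\<^bsub>S\<^esub> sing g b
      = sing (tgt g \<cdot> g) (skew_embedding G e a (tgt g) * act (tgt g) (sing g b g))"
    by (rule skew_mult_single_term, use assms in \<open>simp_all add: tgt_closed src_tgt\<close>)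
      (metis sing_nonzeroD embedding_nonzeroD objectsD(2,3))
  also have "\<dots> = sing g (a * b)"
  proof -
    have b: "b * e (tgt g) = b" using D_tgt assms D_iff tgt_closed by blast
    then have "a * e (tgt g) * (b * e (tgt g)) = a * b"
      using e_comm[OF tgt_closed[OF assms(1)], of b] by (simp add: mult.assoc)
    then show ?thesis
      using assms by (simp add: tgt_comp_id skew_embedding_def tgt_object act_object_eq sing_def)
  qed
  finally show ?thesis .
qed

lemma sing_mult_embedding:
  assumes "g \<in> carrier G" "a \<in> D g"
  shows "sing g a \<otimes>\<^bsub>S\<^esub> skew_embedding G e b = sing g (a * act g b)"
proof -
  have "sing g a \<otimes>\<^bsub>S\<^esub> skew_embedding G e b
      = sing (g \<cdot> src g) (sing g a g * act g (skew_embedding G e b (src g)))"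
    by (rule skew_mult_single_term, use assms in \<open>simp_all add: src_closed tgt_src\<close>)
      (metis sing_nonzeroD embedding_nonzeroD objectsD(2,3))
  then show ?thesis
    using assms by (simp add: comp_src skew_embedding_def src_object sing_def act_mult act_e_src act_e)
qed

lemma skew_one_sing:
  assumes "g \<in> carrier G" "a \<in> D g"
  shows "\<one>\<^bsub>S\<^esub> \<otimes>\<^bsub>S\<^esub> sing g a = sing g a" "sing g a \<otimes>\<^bsub>S\<^esub> \<one>\<^bsub>S\<^esub> = sing g a"
proof -
  have "\<one>\<^bsub>S\<^esub> \<otimes>\<^bsub>S\<^esub> sing g a = sing (tgt g \<cdot> g) (\<one>\<^bsub>S\<^esub> (tgt g) * act (tgt g) (sing g a g))"
    by (rule skew_mult_single_term, use assms in \<open>simp_all add: tgt_closed src_tgt\<close>)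
      (metis sing_nonzeroD one_nonzeroD objectsD(2,3))
  also have "\<dots> = sing g a"
  proof -
    have "a * e (tgt g) = a" using D_tgt assms D_iff tgt_closed by blast
    then show ?thesis
      using assms e_comm[OF tgt_closed[OF assms(1)], of a]
      by (simp add: tgt_comp_id skew_simps tgt_object act_object_eq sing_def)
  qed
  finally show "\<one>\<^bsub>S\<^esub> \<otimes>\<^bsub>S\<^esub> sing g a = sing g a" .
  have "sing g a \<otimes>\<^bsub>S\<^esub> \<one>\<^bsub>S\<^esub> = sing (g \<cdot> src g) (sing g a g * act g (\<one>\<^bsub>S\<^esub> (src g)))"
    by (rule skew_mult_single_term, use assms in \<open>simp_all add: src_closed tgt_src\<close>)
      (metis sing_nonzeroD one_nonzeroD objectsD(2,3))
  then show "sing g a \<otimes>\<^bsub>S\<^esub> \<one>\<^bsub>S\<^esub> = sing g a"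
    using assms by (simp add: comp_src skew_simps(3) src_object act_e_src D_iff)
qed

lemma skew_ring: "ring S"
proof (rule ringI)
  show "abelian_group S"
  proof (rule abelian_groupI)
    show "\<exists>v \<in> carrier S. v \<oplus>\<^bsub>S\<^esub> u = \<zero>\<^bsub>S\<^esub>" if "u \<in> carrier S" for u
      using that by (intro bexI[of _ "\<lambda>g. - u g"]) (auto simp: skew_simps skew_carrier D_minus)
  qed (auto simp: skew_add_closed skew_zero_closed, auto simp: skew_simps ac_simps)
  show "monoid S"
  proof (rule monoidI)
    show "\<one>\<^bsub>S\<^esub> \<otimes>\<^bsub>S\<^esub> u = u" if "u \<in> carrier S" for u
      using that
      by (induction u rule: skew_induct) (simp_all add: skew_mult_zero skew_one_sing skew_r_distr)
    show "u \<otimes>\<^bsub>S\<^esub> \<one>\<^bsub>S\<^esub> = u" if "u \<in> carrier S" for u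
      using that
      by (induction u rule: skew_induct) (simp_all add: skew_mult_zero skew_one_sing skew_l_distr)
  qed (auto simp: skew_mult_closed skew_one_closed skew_assoc)
qed (auto simp: skew_l_distr skew_r_distr)

sublocale S: ring S by (rule skew_ring)

lemma skew_finsum:
  assumes "finite I" "f \<in> I \<rightarrow> carrier S"
  shows "(\<Oplus>\<^bsub>S\<^esub>i\<in>I. f i) = (\<lambda>k. \<Sum>i\<in>I. f i k)"
  using assms
proof (induction I rule: finite_induct)
  case empty
  then show ?case by (simp add: skew_simps)
next
  case (insert i F)
  then show ?case by (subst S.finsum_insert) (auto simp: skew_simps Pi_iff)
qed

end

section \<open>The separability element and the embedding of A\<close>

context finite_unital_partial_action
begin

text \<open>The Casimir identity for a monomial. Left composition with \<open>h\<close> maps the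
  arrows from \<open>x\<close> to \<open>src h\<close> bijectively onto those from \<open>x\<close>
  to \<open>tgt h\<close>; the term of \<open>g\<close> on the left equals the term of
  \<open>h \<cdot> g\<close> on the right, and all other terms contain a product of non-composable
  monomials.\<close>

lemma casimir_sing:
  assumes M: "abelian_group M" and \<beta>: "balanced_map (range (skew_embedding G e)) S M \<beta>"
    and x: "x \<in> objects G" and c: "c \<in> center_of UNIV"
    and h: "h \<in> carrier G" and a: "a \<in> D h"
  defines "I \<equiv> {g \<in> carrier G. src g = x}"
    and "p \<equiv> \<lambda>g. sing g (act g c)" and "q \<equiv> \<lambda>g. sing (ginv G g) (e (ginv G g))"
  shows "(\<Oplus>\<^bsub>M\<^esub>g\<in>I. \<beta> (sing h a \<otimes>\<^bsub>S\<^esub> p g) (q g)) = (\<Oplus>\<^bsub>M\<^esub>g\<in>I. \<beta> (p g) (q g \<otimes>\<^bsub>S\<^esub> sing h a))"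
proof -
  interpret M: abelian_group M by fact
  note closed = balanced_mapD(1)[OF \<beta>]
  note \<beta>0 = balanced_map_zero[OF \<beta> S.abelian_group_axioms M]
  have I: "finite I" using finite_carrier by (simp add: I_def)
  have p: "p g \<in> carrier S" and q: "q g \<in> carrier S" if "g \<in> I" for g
    using that by (auto simp: p_def q_def I_def intro!: sing_closed act_closed D_e ginv_props)
  have s: "sing h a \<in> carrier S" using h a by (rule sing_closed)
  let ?L = "\<lambda>g. \<beta> (sing h a \<otimes>\<^bsub>S\<^esub> p g) (q g)" and ?R = "\<lambda>g. \<beta> (p g) (q g \<otimes>\<^bsub>S\<^esub> sing h a)"
  let ?J = "{g \<in> I. tgt g = src h}" and ?K = "{g \<in> I. tgt g = tgt h}"
  have L: "?L g \<in> carrier M" and R: "?R g \<in> carrier M" if "g \<in> I" for g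
    using that p q s by (auto intro!: closed)
  have "(\<Oplus>\<^bsub>M\<^esub>g\<in>I. ?L g) = (\<Oplus>\<^bsub>M\<^esub>g\<in>?J. ?L g)"
  proof (rule M.add.finprod_mono_neutral_cong_right)
    show "?L g = \<zero>\<^bsub>M\<^esub>" if "g \<in> I - ?J" for g
    proof -
      have "sing h a \<otimes>\<^bsub>S\<^esub> p g = \<zero>\<^bsub>S\<^esub>"
        using that h by (auto simp: p_def sing_mult I_def)
      then show ?thesis using \<beta>0 q that by simp
    qed
  qed (use I L in auto)
  also have "\<dots> = (\<Oplus>\<^bsub>M\<^esub>g\<in>?J. ?R (h \<cdot> g))"
  proof (rule M.finsum_cong')
    fix g assume g: "g \<in> ?J"
    then have gG: "g \<in> carrier G" and gh: "src h = tgt g" by (auto simp: I_def)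
    let ?k = "h \<cdot> g"
    have k: "?k \<in> carrier G" "src ?k = src g" "tgt ?k = tgt h"
      using h gG gh by (auto simp: comp_closed src_comp tgt_comp)
    then have kI: "?k \<in> I" using g by (simp add: I_def)
    have ik: "ginv G ?k \<in> carrier G" "src (ginv G ?k) = tgt h"
      using k by (simp_all add: ginv_props)
    have ikh: "ginv G ?k \<cdot> h = ginv G g"
    proof -
      have "ginv G ?k \<cdot> h = ginv G g \<cdot> (ginv G h \<cdot> h)"
        using h gG gh by (simp add: ginv_comp comp_assoc ginv_props)
      also have "\<dots> = ginv G g \<cdot> src (ginv G g)"
        using h gG gh by (simp add: ginv_props)
      also have "\<dots> = ginv G g" using gG by (intro comp_src ginv_props)
      finally show ?thesis .
    qed
    \<comment> \<open>The coefficient \<open>a\<close> is transported back along \<open>?k\<close>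
      to the object \<open>x\<close>; in this form it can slide across the tensor sign as an element
      of A.\<close>
    define b where "b = act (ginv G ?k) a"
    \<comment> \<open>As \<open>a\<close> lies in \<open>D h\<close>, its image lies in the ideal of
      \<open>ginv G ?k \<cdot> h\<close>, which is \<open>ginv G g\<close>. So \<open>b\<close>
      loses nothing when it meets the coefficient of \<open>q g\<close>.\<close>
    have b: "b * e (ginv G g) = b"
    proof -
      have "b = act (ginv G ?k) a * act (ginv G ?k) (e h)"
        using a h ik by (simp add: b_def D_iff flip: act_mult)
      also have "\<dots> = act (ginv G ?k) a * (e (ginv G ?k) * e (ginv G g))"
        using act_e_comp[OF ik(1) h ik(2)] by (simp only: ikh)
      also have "\<dots> = b * e (ginv G g)"
        using act_e ik by (simp add: b_def flip: mult.assoc)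
      finally show ?thesis by simp
    qed
    have ah: "a * e h = a" using a h by (simp add: D_iff)
    have kb: "act ?k b = e ?k * a"
    proof -
      have "act ?k b = e ?k * act (tgt ?k) a"
        unfolding b_def using act_act[OF k(1) ik(1), of a] k by (simp add: ginv_props)
      also have "\<dots> = e ?k * (e (tgt ?k) * a)"
        using act_object_eq[OF tgt_object[OF k(1)]] e_comm[OF tgt_closed[OF k(1)]] by simp
      also have "\<dots> = e ?k * a"
        using e_tgt(1)[OF k(1)] by (simp flip: mult.assoc)
      finally show ?thesis .
    qed
    have "sing h a \<otimes>\<^bsub>S\<^esub> p g = sing ?k (a * act ?k c)"
    proof -
      have "a * act h (act g c) = a * e h * act ?k c"
        using act_act h gG gh by (simp add: mult.assoc)
      then show ?thesis using h gG gh ah by (simp add: p_def sing_mult)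
    qed
    \<comment> \<open>Centrality moves \<open>a\<close> to the right of \<open>act ?k c\<close>,
      which supplies the factor \<open>e ?k\<close> needed to rewrite \<open>a\<close> as
      \<open>act ?k b\<close>. Only then has the product the shape of a right multiplication by an
      embedded element.\<close>
    also have "a * act ?k c = act ?k c * act ?k b"
      using act_e(1)[OF k(1), of c] act_central[OF k(1) c, of a] by (simp add: kb flip: mult.assoc)
    also have "sing ?k (act ?k c * act ?k b) = p ?k \<otimes>\<^bsub>S\<^esub> skew_embedding G e b"
      using sing_mult_embedding[OF k(1) act_closed[OF k(1)]] by (simp add: p_def)
    finally have "?L g = \<beta> (p ?k \<otimes>\<^bsub>S\<^esub> skew_embedding G e b) (q g)" by simp
    also have "\<dots> = \<beta> (p ?k) (skew_embedding G e b \<otimes>\<^bsub>S\<^esub> q g)"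
      by (rule balanced_mapD(4)[OF \<beta> p[OF kI]]) (use q g in auto)
    also have "skew_embedding G e b \<otimes>\<^bsub>S\<^esub> q g = q ?k \<otimes>\<^bsub>S\<^esub> sing h a"
    proof -
      have "skew_embedding G e b \<otimes>\<^bsub>S\<^esub> q g = sing (ginv G g) b"
        using gG b by (simp add: q_def embedding_mult_sing ginv_props D_e)
      also have "\<dots> = q ?k \<otimes>\<^bsub>S\<^esub> sing h a"
        using ik h by (simp add: q_def sing_mult b_def act_e ikh)
      finally show ?thesis .
    qed
    finally show "?L g = ?R (h \<cdot> g)" .
  next
    show "(\<lambda>g. ?R (h \<cdot> g)) \<in> ?J \<rightarrow> carrier M"
      using h R by (auto simp: I_def comp_closed src_comp)
  qed simp
  also have "\<dots> = (\<Oplus>\<^bsub>M\<^esub>g\<in>(\<lambda>g. h \<cdot> g) ` ?J. ?R g)"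
  proof (rule M.finsum_reindex[symmetric])
    show "inj_on (\<lambda>g. h \<cdot> g) ?J"
      by (rule inj_on_inverseI[of _ "\<lambda>g. ginv G h \<cdot> g"]) (use h in \<open>auto simp: ginv_comp_cancel I_def\<close>)
    show "?R \<in> (\<lambda>g. h \<cdot> g) ` ?J \<rightarrow> carrier M"
      using h R by (auto simp: I_def comp_closed src_comp)
  qed
  also have "(\<lambda>g. h \<cdot> g) ` ?J = ?K"
  proof (intro equalityI subsetI)
    fix k assume k: "k \<in> ?K"
    then have "h \<cdot> (ginv G h \<cdot> k) = k" "ginv G h \<cdot> k \<in> ?J"
      using h by (auto simp: I_def ginv_comp_cancel ginv_props comp_closed src_comp tgt_comp)
    then show "k \<in> (\<lambda>g. h \<cdot> g) ` ?J" by (metis imageI)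
  qed (use h in \<open>auto simp: I_def comp_closed src_comp tgt_comp\<close>)
  also have "(\<Oplus>\<^bsub>M\<^esub>g\<in>?K. ?R g) = (\<Oplus>\<^bsub>M\<^esub>g\<in>I. ?R g)"
  proof (rule M.add.finprod_mono_neutral_cong_left)
    show "?R g = \<zero>\<^bsub>M\<^esub>" if "g \<in> I - ?K" for g
    proof -
      have "q g \<otimes>\<^bsub>S\<^esub> sing h a = \<zero>\<^bsub>S\<^esub>"
        using that h by (auto simp: q_def sing_mult I_def ginv_props)
      then show ?thesis using \<beta>0 p that by simp
    qed
  qed (use I R in auto)
  finally show ?thesis .
qed

text \<open>The products of the two factors are concentrated on objects. Grouping them by target
  makes their sum equal to 1 precisely through the trace identity at every object; the Casimir
  identity extends from monomials by additivity.\<close>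

lemma skew_separability_system:
  fixes M :: "('b, 'c) ring_scheme"
  assumes M: "abelian_group M" and x: "x \<in> objects G" and c: "c \<in> center_of UNIV"
    and trace: "\<And>y. y \<in> objects G \<Longrightarrow> (\<Sum>g \<in> {g \<in> carrier G. src g = x \<and> tgt g = y}. act g c) = e y"
  shows "separability_system (range (skew_embedding G e)) S M {g \<in> carrier G. src g = x}
     (\<lambda>g. sing g (act g c)) (\<lambda>g. sing (ginv G g) (e (ginv G g)))"
    (is "separability_system ?A S M ?I ?p ?q")
  unfolding separability_system_def
proof (intro conjI allI impI ballI)
  interpret M: abelian_group M by fact
  show I: "finite ?I" using finite_carrier by simp
  show p: "?p \<in> ?I \<rightarrow> carrier S" and q: "?q \<in> ?I \<rightarrow> carrier S"
    by (auto intro!: sing_closed act_closed D_e ginv_props)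
  show "(\<Oplus>\<^bsub>S\<^esub>g\<in>?I. ?p g \<otimes>\<^bsub>S\<^esub> ?q g) = \<one>\<^bsub>S\<^esub>"
  proof
    fix k
    \<comment> \<open>The arrow \<open>g\<close> composed with its inverse is \<open>tgt g\<close>,
      and \<open>act g\<close> sends the idempotent of the second factor to \<open>e g\<close>,
      which \<open>act g c\<close> absorbs.\<close>
    have pq: "?p g \<otimes>\<^bsub>S\<^esub> ?q g = sing (tgt g) (act g c)" if "g \<in> ?I" for g
      using that by (simp add: sing_mult ginv_props act_e_ginv act_e)
    have "(\<Oplus>\<^bsub>S\<^esub>g\<in>?I. ?p g \<otimes>\<^bsub>S\<^esub> ?q g) k = (\<Sum>g\<in>?I. (?p g \<otimes>\<^bsub>S\<^esub> ?q g) k)"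
      using skew_finsum[OF I, of "\<lambda>g. ?p g \<otimes>\<^bsub>S\<^esub> ?q g"] p q by (simp add: Pi_iff)
    also have "\<dots> = (\<Sum>g\<in>?I. if tgt g = k then act g c else 0)"
      by (rule sum.cong) (simp_all add: pq, simp add: sing_def eq_commute)
    also have "\<dots> = (\<Sum>g \<in> {g \<in> carrier G. src g = x \<and> tgt g = k}. act g c)"
      using I by (simp add: sum.inter_filter[symmetric] conj_assoc)
    also have "\<dots> = \<one>\<^bsub>S\<^esub> k"
    proof (cases "k \<in> objects G")
      case True
      then show ?thesis by (simp add: trace skew_simps)
    next
      case False
      then have "{g \<in> carrier G. src g = x \<and> tgt g = k} = {}" using tgt_object by blast
      then show ?thesis using False by (simp only: skew_simps sum.empty if_False)
    qed
    finally show "(\<Oplus>\<^bsub>S\<^esub>g\<in>?I. ?p g \<otimes>\<^bsub>S\<^esub> ?q g) k = \<one>\<^bsub>S\<^esub> k" .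
  qed
  fix \<beta> s
  assume \<beta>: "balanced_map ?A S M \<beta>" and s: "s \<in> carrier S"
  note closed = balanced_mapD(1)[OF \<beta>]
  note \<beta>0 = balanced_map_zero[OF \<beta> S.abelian_group_axioms M]
  note add1 = balanced_mapD(2)[OF \<beta>] and add2 = balanced_mapD(3)[OF \<beta>]
  have pI: "?p g \<in> carrier S" and qI: "?q g \<in> carrier S" if "g \<in> ?I" for g
    using that p q by auto
  show "(\<Oplus>\<^bsub>M\<^esub>g\<in>?I. \<beta> (s \<otimes>\<^bsub>S\<^esub> ?p g) (?q g)) = (\<Oplus>\<^bsub>M\<^esub>g\<in>?I. \<beta> (?p g) (?q g \<otimes>\<^bsub>S\<^esub> s))"
    using s
  proof (induction s rule: skew_induct)
    case zero
    have "(\<Oplus>\<^bsub>M\<^esub>g\<in>?I. \<beta> (\<zero>\<^bsub>S\<^esub> \<otimes>\<^bsub>S\<^esub> ?p g) (?q g)) = (\<Oplus>\<^bsub>M\<^esub>g\<in>?I. \<zero>\<^bsub>M\<^esub>)"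
      by (rule M.finsum_cong') (simp_all add: skew_mult_zero \<beta>0 qI)
    moreover have "(\<Oplus>\<^bsub>M\<^esub>g\<in>?I. \<beta> (?p g) (?q g \<otimes>\<^bsub>S\<^esub> \<zero>\<^bsub>S\<^esub>)) = (\<Oplus>\<^bsub>M\<^esub>g\<in>?I. \<zero>\<^bsub>M\<^esub>)"
      by (rule M.finsum_cong') (simp_all add: skew_mult_zero \<beta>0 pI)
    ultimately show ?case by simp
  next
    case (sing h a)
    then show ?case using casimir_sing[OF M \<beta> x c] by blast
  next
    case (add u v)
    have "(\<Oplus>\<^bsub>M\<^esub>g\<in>?I. \<beta> ((u \<oplus>\<^bsub>S\<^esub> v) \<otimes>\<^bsub>S\<^esub> ?p g) (?q g))
        = (\<Oplus>\<^bsub>M\<^esub>g\<in>?I. \<beta> (u \<otimes>\<^bsub>S\<^esub> ?p g) (?q g) \<oplus>\<^bsub>M\<^esub> \<beta> (v \<otimes>\<^bsub>S\<^esub> ?p g) (?q g))"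
      by (rule M.finsum_cong') (use add.hyps pI qI in \<open>auto simp: skew_l_distr add1 closed\<close>)
    also have "\<dots> = (\<Oplus>\<^bsub>M\<^esub>g\<in>?I. \<beta> (u \<otimes>\<^bsub>S\<^esub> ?p g) (?q g)) \<oplus>\<^bsub>M\<^esub> (\<Oplus>\<^bsub>M\<^esub>g\<in>?I. \<beta> (v \<otimes>\<^bsub>S\<^esub> ?p g) (?q g))"
      by (rule M.finsum_addf) (use add.hyps pI qI in \<open>auto simp: closed\<close>)
    also have "\<dots> = (\<Oplus>\<^bsub>M\<^esub>g\<in>?I. \<beta> (?p g) (?q g \<otimes>\<^bsub>S\<^esub> u)) \<oplus>\<^bsub>M\<^esub> (\<Oplus>\<^bsub>M\<^esub>g\<in>?I. \<beta> (?p g) (?q g \<otimes>\<^bsub>S\<^esub> v))"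
      by (simp only: add.IH)
    also have "\<dots> = (\<Oplus>\<^bsub>M\<^esub>g\<in>?I. \<beta> (?p g) (?q g \<otimes>\<^bsub>S\<^esub> u) \<oplus>\<^bsub>M\<^esub> \<beta> (?p g) (?q g \<otimes>\<^bsub>S\<^esub> v))"
      by (rule M.finsum_addf[symmetric]) (use add.hyps pI qI in \<open>auto simp: closed\<close>)
    also have "\<dots> = (\<Oplus>\<^bsub>M\<^esub>g\<in>?I. \<beta> (?p g) (?q g \<otimes>\<^bsub>S\<^esub> (u \<oplus>\<^bsub>S\<^esub> v)))"
      by (rule M.finsum_cong') (use add.hyps pI qI in \<open>auto simp: skew_r_distr add2 closed\<close>)
    finally show ?case .
  qed
qed

text \<open>Composition with \<open>t\<close> identifies the isotropy group of \<open>x\<close> with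
  the arrows from \<open>x\<close> to \<open>tgt t\<close>, so it suffices to apply
  \<open>act t\<close> to the trace identity. The equalities of ideals give
  \<open>act t (e x) = e (tgt t)\<close> and make the defect \<open>e t\<close> from
  \<open>act_act\<close> the identity of the ideal at \<open>tgt t\<close>, so it
  disappears.\<close>

lemma sum_act_transport:
  assumes x: "x \<in> objects G" and t: "t \<in> carrier G" "src t = x"
    and D: "D (ginv G t) = D x" "D t = D (tgt t)"
    and trace: "(\<Sum>h \<in> isotropy G x. act h c) = e x"
  shows "(\<Sum>g \<in> {g \<in> carrier G. src g = x \<and> tgt g = tgt t}. act g c) = e (tgt t)"
proof -
  have et: "e t = e (tgt t)" using e_eqI[OF t(1) tgt_closed[OF t(1)] D(2)] .
  have ex: "e (ginv G t) = e x" using e_eqI[OF ginv_props(1)[OF t(1)] objectsD(1)[OF x] D(1)] .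
  have "(\<Sum>g \<in> {g \<in> carrier G. src g = x \<and> tgt g = tgt t}. act g c) = (\<Sum>h \<in> isotropy G x. act t (act h c))"
  proof (rule sum.reindex_bij_witness[of _ "\<lambda>h. t \<cdot> h" "\<lambda>g. ginv G t \<cdot> g"])
    fix g assume "g \<in> {g \<in> carrier G. src g = x \<and> tgt g = tgt t}"
    then have g: "g \<in> carrier G" "src g = x" "tgt g = tgt t" by auto
    show "t \<cdot> (ginv G t \<cdot> g) = g" using g t by (simp add: ginv_comp_cancel)
    show "ginv G t \<cdot> g \<in> isotropy G x"
      using g t by (simp add: isotropy_def comp_closed src_comp tgt_comp ginv_props)
    have "act t (act (ginv G t \<cdot> g) c) = e t * act g c"
      using g t by (simp add: act_act comp_closed tgt_comp ginv_props ginv_comp_cancel)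
    also have "\<dots> = e (tgt g) * (e g * act g c)"
      using g et by (simp add: act_e)
    also have "\<dots> = act g c"
      using act_e(2)[OF g(1)] e_tgt(2)[OF g(1)] by (metis mult.assoc)
    finally show "act t (act (ginv G t \<cdot> g) c) = act g c" .
  qed (use t in \<open>auto simp: isotropy_def ginv_comp_cancel comp_closed src_comp tgt_comp\<close>)
  also have "\<dots> = act t (e x)" using t by (simp add: trace flip: act_sum)
  also have "\<dots> = e (tgt t)" using act_e_ginv[OF t(1)] by (simp add: ex et)
  finally show ?thesis .
qed

text \<open>Because \<open>c\<close> absorbs \<open>e g\<close>, any \<open>b\<close> may be
  replaced by \<open>b * e g\<close>, which lies in \<open>D g\<close>. This lifts \<open>c\<close>
  from the center of A_x to the center of A, as moving arbitrary coefficients past it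
  requires.\<close>

lemma center_of_D:
  assumes "g \<in> carrier G" "c \<in> center_of (D g)"
  shows "c \<in> center_of UNIV"
proof -
  have c: "c * e g = c" "\<And>b. b \<in> D g \<Longrightarrow> c * b = b * c"
    using assms by (auto simp: center_of_def D_iff)
  have "c * b = b * c" for b
  proof -
    have "c * b = c * (b * e g)" using c(1) assms e_comm by (metis mult.assoc)
    also have "\<dots> = b * e g * c" using c(2) assms D_e by blast
    also have "\<dots> = b * c" using c(1) assms e_comm by (metis mult.assoc)
    finally show ?thesis .
  qed
  then show ?thesis by (simp add: center_of_def)
qed

lemma direct_sum_e:
  assumes "internal_direct_sum (objects G) D"
  shows "\<And>y z. y \<in> objects G \<Longrightarrow> z \<in> objects G \<Longrightarrow> y \<noteq> z \<Longrightarrow> e y * e z = 0"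
    and "(\<Sum>y \<in> objects G. a * e y) = a"
proof -
  have fin: "finite (objects G)" using finite_carrier by (simp add: objects_def)
  have unique: "f = f'" if "f \<in> Pi\<^sub>E (objects G) D" "f' \<in> Pi\<^sub>E (objects G) D"
    "sum f (objects G) = sum f' (objects G)" for f f'
    using assms that unfolding internal_direct_sum_def by metis
  show orth: "e y * e z = 0" if yz: "y \<in> objects G" "z \<in> objects G" "y \<noteq> z" for y z
  proof -
    \<comment> \<open>The product \<open>e y * e z\<close> belongs to both \<open>D y\<close> and
      \<open>D z\<close>. Placing it in coordinate \<open>y\<close> or in coordinate
      \<open>z\<close> gives two decompositions of the same element, so uniqueness makes it
      zero.\<close>
    define f where "f w = (\<lambda>v \<in> objects G. if v = w then e y * e z else 0)" for w
    have "f w \<in> Pi\<^sub>E (objects G) D" if "w = y \<or> w = z" for w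
      using that yz by (auto simp: f_def D_zero D_e objectsD)
    moreover have "sum (f w) (objects G) = e y * e z" if "w = y \<or> w = z" for w
      using that yz fin by (auto simp: f_def)
    ultimately have "f y = f z" using unique by metis
    then have "f y y = f z y" by simp
    then show ?thesis using yz by (simp add: f_def)
  qed
  obtain f where f: "f \<in> Pi\<^sub>E (objects G) D" "a = sum f (objects G)"
    using assms unfolding internal_direct_sum_def by metis
  \<comment> \<open>Orthogonality identifies the component of \<open>a\<close> at \<open>y\<close>
    as \<open>a * e y\<close>.\<close>
  have "a * e y = f y" if y: "y \<in> objects G" for y
  proof -
    have "a * e y = (\<Sum>z \<in> objects G. f z * e y)" by (simp add: f(2) sum_distrib_right)
    also have "\<dots> = (\<Sum>z \<in> objects G. if z = y then f y else 0)"
    proof (rule sum.cong)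
      fix z assume z: "z \<in> objects G"
      have fz: "f z * e z = f z" using f z objectsD D_iff by (metis PiE_E)
      then have "f z * e y = f z * (e z * e y)" by (simp flip: mult.assoc)
      then show "f z * e y = (if z = y then f y else 0)" using orth z y fz by auto
    qed simp
    also have "\<dots> = f y" using y fin by simp
    finally show ?thesis .
  qed
  then show "(\<Sum>y \<in> objects G. a * e y) = a" by (simp add: f(2))
qed

text \<open>Embedded elements are supported on objects. Two composable objects are equal and compose
  to themselves, so only the pair (k, k) can contribute, and nothing contributes when
  \<open>k\<close> is not an object.\<close>

lemma skew_embedding_mult:
  "skew_embedding G e a \<otimes>\<^bsub>S\<^esub> skew_embedding G e b = skew_embedding G e (a * b)"
proof
  fix k
  let ?\<phi> = "skew_embedding G e"
  show "(?\<phi> a \<otimes>\<^bsub>S\<^esub> ?\<phi> b) k = ?\<phi> (a * b) k"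
  proof (cases "k \<in> objects G")
    case True
    have "(?\<phi> a \<otimes>\<^bsub>S\<^esub> ?\<phi> b) k = (\<Sum>p \<in> factorizations k. if (k, k) = p then a * b * e k else 0)"
      unfolding skew_mult
    proof (rule sum.cong)
      fix p assume p: "p \<in> factorizations k"
      obtain g h where gh: "p = (g, h)" by (cases p)
      show "(case p of (g, h) \<Rightarrow> ?\<phi> a g * act g (?\<phi> b h)) = (if (k, k) = p then a * b * e k else 0)"
      proof (cases "g \<in> objects G \<and> h \<in> objects G")
        case True
        from p have "src g = tgt h" "g \<cdot> h = k" "h \<in> carrier G"
          by (simp_all add: gh factorizations_def)
        with True have "g = k" "h = k" using object_comp[of h g] objectsD by metis+
        moreover have "a * e k * (b * e k * e k) = a * b * e k"
          using \<open>k \<in> objects G\<close> by (metis e_comm e_idem mult.assoc objectsD(1))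
        ultimately show ?thesis
          using \<open>k \<in> objects G\<close> by (simp add: gh skew_embedding_def act_object_eq)
      next
        case False
        moreover have "(k, k) \<noteq> p" using False True by (auto simp: gh)
        ultimately show ?thesis
          using p by (auto simp: gh skew_embedding_def factorizations_def act_zero)
      qed
    qed simp
    also have "\<dots> = a * b * e k"
      using True comp_src[of k] by (simp add: finite_factorizations, simp add: factorizations_def objectsD)
    finally show ?thesis using True by (simp add: skew_embedding_def)
  next
    case False
    have "?\<phi> a g * act g (?\<phi> b h) = 0" if "(g, h) \<in> factorizations k" for g h
      using that False object_comp[of h g]
      by (auto simp: skew_embedding_def factorizations_def act_zero)
    then have "(?\<phi> a \<otimes>\<^bsub>S\<^esub> ?\<phi> b) k = 0" unfolding skew_mult by (intro sum.neutral) auto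
    then show ?thesis using False by (simp add: skew_embedding_def)
  qed
qed

lemma skew_embedding_closed: "skew_embedding G e a \<in> carrier S"
  by (auto simp: skew_carrier skew_embedding_def D_zero D_e objectsD)

lemma skew_embedding_add:
  "skew_embedding G e (a + b) = skew_embedding G e a \<oplus>\<^bsub>S\<^esub> skew_embedding G e b"
  by (auto simp: skew_embedding_def skew_simps distrib_right)

lemma ring_embedding_skew:
  assumes "internal_direct_sum (objects G) D"
  shows "ring_embedding (skew_embedding G e) S"
  unfolding ring_embedding_def
proof (intro conjI allI)
  show "inj (skew_embedding G e)"
  proof (rule injI)
    fix a b assume eq: "skew_embedding G e a = skew_embedding G e b"
    have "a * e y = b * e y" if "y \<in> objects G" for y
      using fun_cong[OF eq, of y] that by (simp add: skew_embedding_def)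
    then have "(\<Sum>y \<in> objects G. a * e y) = (\<Sum>y \<in> objects G. b * e y)" by (rule sum.cong[OF refl])
    then show "a = b" unfolding direct_sum_e(2)[OF assms] .
  qed
qed (simp_all only: skew_embedding_add skew_embedding_mult, use skew_embedding_closed in blast)

lemma unital_ring_extension_skew:
  assumes "internal_direct_sum (objects G) D"
  shows "unital_ring_extension (range (skew_embedding G e)) S"
  unfolding unital_ring_extension_def
proof
  let ?\<phi> = "skew_embedding G e"
  show "subring (range ?\<phi>) S"
  proof (rule S.subringI)
    \<comment> \<open>The base ring comes without a designated identity; the sum of the idempotents
      of the objects is its identity and is sent to the identity of \<open>S\<close>.\<close>
    have "?\<phi> (\<Sum>y \<in> objects G. e y) k = \<one>\<^bsub>S\<^esub> k" for k
    proof (cases "k \<in> objects G")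
      case True
      have "(\<Sum>y \<in> objects G. e y) * e k = (\<Sum>y \<in> objects G. e k * e y)"
        using e_comm[OF objectsD(1)[OF True], of "\<Sum>y \<in> objects G. e y"]
        by (simp only: sum_distrib_left)
      then show ?thesis
        using True direct_sum_e(2)[OF assms, of "e k"] by (simp add: skew_simps skew_embedding_def)
    qed (simp add: skew_simps skew_embedding_def)
    then show "\<one>\<^bsub>S\<^esub> \<in> range ?\<phi>" by (intro range_eqI[of _ _ "\<Sum>y \<in> objects G. e y"]) auto
    show "\<ominus>\<^bsub>S\<^esub> u \<in> range ?\<phi>" if "u \<in> range ?\<phi>" for u
    proof -
      obtain a where a: "u = ?\<phi> a" using \<open>u \<in> range ?\<phi>\<close> by blast
      have "?\<phi> (- a) \<oplus>\<^bsub>S\<^esub> ?\<phi> a = \<zero>\<^bsub>S\<^esub>"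
        by (simp add: skew_embedding_def skew_simps fun_eq_iff)
      then have "\<ominus>\<^bsub>S\<^esub> u = ?\<phi> (- a)"
        unfolding a by (intro S.minus_equality) (simp_all add: skew_embedding_closed)
      then show ?thesis by simp
    qed
  qed (auto simp: skew_embedding_closed skew_embedding_mult simp flip: skew_embedding_add)
qed (rule skew_ring)

end

theorem theorem5p9:
  fixes G :: "('g, 'k) groupoid_scheme"
    and D :: "'g \<Rightarrow> 'a::ring set"
    and \<alpha> :: "'g \<Rightarrow> 'a \<Rightarrow> 'a"
    and e :: "'g \<Rightarrow> 'a"
    and x :: 'g
    and \<tau> :: "'g \<Rightarrow> 'g"
  assumes "finite (carrier G)"
    and "connected_groupoid G"
    and "x \<in> objects G"
    and "unital_partial_action G D \<alpha> e"
    and "group_type G D \<alpha>"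
    and "internal_direct_sum (objects G) D"
    and "transversal G x \<tau>"
    and "\<forall>y \<in> objects G. D (ginv G (\<tau> y)) = D x \<and> D (\<tau> y) = D y"
    and "\<exists>a\<^sub>x \<in> center_of (D x). isotropy_trace G \<alpha> e x a\<^sub>x = e x"
    and "\<exists>a \<in> center_of UNIV. (\<Sum>z \<in> objects G. \<alpha> (ginv G (\<tau> z)) (a * e z)) = e x"
  shows "ring_embedding (skew_embedding G e) (skew_groupoid_ring G D \<alpha> e)
    \<and> left_semisimple_extension TYPE('m) (range (skew_embedding G e)) (skew_groupoid_ring G D \<alpha> e)
    \<and> right_semisimple_extension TYPE('m) (range (skew_embedding G e)) (skew_groupoid_ring G D \<alpha> e)"
proof -
  interpret unital_partial_action G D \<alpha> e by fact
  interpret finite_unital_partial_action G D \<alpha> e by unfold_locales fact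
  obtain c where c: "c \<in> center_of (D x)" "isotropy_trace G \<alpha> e x c = e x" using assms(9) by blast
  have trace: "(\<Sum>h \<in> isotropy G x. act h c) = e x"
    using c(2) by (simp add: isotropy_trace_def act_def)
  have central: "c \<in> center_of UNIV" using center_of_D[OF objectsD(1)[OF assms(3)] c(1)] .
  have "(\<Sum>g \<in> {g \<in> carrier G. src\<^bsub>G\<^esub> g = x \<and> tgt\<^bsub>G\<^esub> g = y}. act g c) = e y" if y: "y \<in> objects G" for y
    using sum_act_transport[OF assms(3) _ _ _ _ trace, of "\<tau> y"] assms(7,8) y
    by (auto simp: transversal_def)
  \<comment> \<open>The abelian group \<open>M\<close> is left open, so the same fact feeds both the
    left and the right criterion.\<close>
  note sep = skew_separability_system[OF _ assms(3) central this]
  show ?thesis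
    by (intro conjI ring_embedding_skew[OF assms(6)]
        left_semisimple_extensionI[OF unital_ring_extension_skew[OF assms(6)] sep]
        right_semisimple_extensionI[OF unital_ring_extension_skew[OF assms(6)] sep])
qed

end
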